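(* There exists $\delta_0\approx 0.16656<1/6$ such that, when $N$ tends to $+\infty$, we have $$(\log N)^{\delta_0+o(1)}\leqslant \mathcal{T}_0(N)\leqslant \mathcal{T}_1(N)\ll (\log N)^{\delta_0+o(1)}.$$
   Context: For an integer $N\geqslant 1$ and a nonzero tuple of non-negative weights $w=(w(1),\dots,w(N))\in(\mathbb{R}_+)^N$, where $\mathbb{R}_+=[0,+\infty)$, put $\|w\|_1=\sum_{m\leqslant N}w(m)$. Write $(m_1,m_2)$ for the greatest common divisor of the positive integers $m_1$ and $m_2$. Define $$\mathcal{T}_0(N):=\inf_{w\in(\mathbb{R}_+)^N}\left(\frac{N}{\|w\|_1^2}\sum_{m_1,m_2\leqslant N}w(m_1)w(m_2)\frac{(m_1,m_2)}{m_1+m_2}\right),$$ $$\mathcal{T}_1(N):=\inf_{w\in(\mathbb{R}_+)^N}\left(\frac{N}{\|w\|_1^2}\sum_{m_1,m_2\leqslant N}w(m_1)w(m_2)\frac{(m_1,m_2)}{\sqrt{m_1m_2}}\right),$$ where the infima are over nonzero $w$. Here $o(1)$ denotes quantities tending to $0$ as $N\to+\infty$ (not necessarily the same on both sides). *)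

theory Defs
  imports Complex_Main "HOL-Library.Landau_Symbols"
begin

text \<open>A tuple \<open>(w(1), \<dots>, w(N))\<close> is a function on \<open>nat\<close> of which only the values on \<open>{1..N}\<close>
  matter.\<close>

definition weights :: "nat \<Rightarrow> (nat \<Rightarrow> real) set" where
  "weights N = {w. (\<forall>m\<in>{1..N}. 0 \<le> w m) \<and> (\<exists>m\<in>{1..N}. w m \<noteq> 0)}"

definition norm1 :: "nat \<Rightarrow> (nat \<Rightarrow> real) \<Rightarrow> real" where
  "norm1 N w = (\<Sum>m=1..N. w m)"

text \<open>For \<open>N \<ge> 1\<close> the two infima below range over nonempty sets of nonnegative reals, so \<open>INF\<close>
  on \<open>real\<close> is the genuine infimum.\<close>

definition T0 :: "nat \<Rightarrow> real" where
  "T0 N = (INF w\<in>weights N. real N / (norm1 N w)\<^sup>2 *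
     (\<Sum>m1=1..N. \<Sum>m2=1..N. w m1 * w m2 * (real (gcd m1 m2) / (real m1 + real m2))))"

definition T1 :: "nat \<Rightarrow> real" where
  "T1 N = (INF w\<in>weights N. real N / (norm1 N w)\<^sup>2 *
     (\<Sum>m1=1..N. \<Sum>m2=1..N. w m1 * w m2 * (real (gcd m1 m2) / sqrt (real m1 * real m2))))"

end

theory Submission
  imports Defs "HOL-Analysis.Analysis" "HOL-Number_Theory.Prime_Powers"
    "HOL-Computational_Algebra.Squarefree"
begin

text \<open>
  Let \<open>\<delta> = 1 - k + k ln k = 2 k ln (1 + z) - z\<^sup>2\<close> with \<open>k = z + z\<^sup>2\<close>; these equations determine
  \<open>z \<approx> 0.3553\<close>. The number \<open>k ln ln N\<close> of prime factors is critical.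

  Lower bound: the numbers \<open>m \<le> N\<close> with at most \<open>k ln ln N\<close> prime factors are \<open>O(N (ln N) powr (-\<delta>))\<close>
  in number, so that the diagonal alone is large if they carry half of the weight. Otherwise write \<open>gcd\<close> as a
  sum over common squarefree divisors \<open>d\<close> and apply Cauchy--Schwarz with the weights \<open>z ^ omega d\<close>.

  Upper bound: take numbers whose \<open>k ln ln N\<close> prime factors are equidistributed on the \<open>ln ln\<close> scale
  (the same number in each of \<open>K\<close> scales), times one large prime. If the large primes differ, Rankin's trick with
  parameter \<open>z\<close> bounds the gcd sum. If they agree, the two cofactors have the same size; if they first differ, from
  above, in scale \<open>j\<close>, this saves a factor \<open>(ln N) powr (j / K)\<close>, and all scales contribute the same power of
  \<open>ln N\<close> up to an error in the exponent that vanishes as \<open>K\<close> grows.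
\<close>

section \<open>Chebyshev and Mertens estimates\<close>

text \<open>The relation \<open>k = z + z\<^sup>2\<close> is a stationarity condition that arises on
  both sides. For fixed \<open>k\<close>, the number \<open>z\<close> maximises
  \<open>2 k ln (1 + z) - z\<^sup>2\<close>, the gain of Cauchy--Schwarz in the lower bound, and it
  minimises \<open>2 z + z\<^sup>2 - 2 k ln z\<close>, the exponent of Rankin's bound for pairs in
  the upper bound. The expression \<open>1 - k + k ln k\<close> is the large deviation exponent of a
  Poisson variable; equating it with the Cauchy--Schwarz gain fixes \<open>k\<close>, as there the
  diagonal and the common divisors cost the same. The obstacle in the upper bound is the pairs that
  share the large prime, whose gcd is exceptionally large. To see that they are rare, pairs agreeing
  above a given scale must be counted through their prime factors up to that scale alone. This is
  why the number of primes is prescribed on every scale: a prescribed total would leave that count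
  open. The vanishing error in the exponent comes from the two ends of the \<open>ln ln\<close> axis
  that carry no scale; they cost \<open>T\<^sup>2\<close>, that is
  \<open>(ln N) powr (2 / (K + 2))\<close>.\<close>

lemma sum_dvd_swap:
  fixes g :: "nat \<Rightarrow> nat \<Rightarrow> real"
  shows "(\<Sum>n=1..N. \<Sum>d | d dvd n. g d n) = (\<Sum>d=1..N. \<Sum>m=1..N div d. g d (d * m))"
proof -
  have *: "d \<le> N" if "d * m \<le> N" "Suc 0 \<le> m" for d m
    using that by (metis dual_order.trans mult_le_mono2 mult.right_neutral One_nat_def)
  have "(\<Sum>n=1..N. \<Sum>d | d dvd n. g d n) = (\<Sum>(n,d)\<in>(SIGMA n:{1..N}. {d. d dvd n}). g d n)"
    by (subst sum.Sigma) auto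
  also have "\<dots> = (\<Sum>(d,m)\<in>(SIGMA d:{1..N}. {1..N div d}). g d (d * m))"
    by (rule sum.reindex_bij_witness[where i="\<lambda>(d,m). (d * m, d)" and j="\<lambda>(n,d). (d, n div d)"])
       (auto simp: less_eq_div_iff_mult_less_eq mult.commute dest: * elim!: dvdE)
  also have "\<dots> = (\<Sum>d=1..N. \<Sum>m=1..N div d. g d (d * m))"
    by (subst sum.Sigma) auto
  finally show ?thesis .
qed

text \<open>Legendre's formula: \<open>ln\<close> is the divisor sum of \<open>mangoldt\<close>, and
  \<open>N div d\<close> counts the multiples of \<open>d\<close> up to \<open>N\<close>.\<close>

lemma ln_fact_mangoldt: "ln (fact N) = (\<Sum>d=1..N. mangoldt d * real (N div d))"
proof -
  have "ln (fact N :: real) = (\<Sum>n=1..N. ln (real n))"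
    by (subst fact_prod, subst of_nat_prod, subst ln_prod) auto
  also have "\<dots> = (\<Sum>n=1..N. \<Sum>d | d dvd n. mangoldt d)"
    by (intro sum.cong refl) (subst mangoldt_sum, auto)
  also have "\<dots> = (\<Sum>d=1..N. mangoldt d * real (N div d))"
    by (subst sum_dvd_swap) (simp add: mult.commute)
  finally show ?thesis .
qed

section \<open>Chebyshev's function \<psi> and its upper bound\<close>

definition psi :: "nat \<Rightarrow> real" where "psi N = (\<Sum>d=1..N. mangoldt d)"

lemma psi_mono: "m \<le> n \<Longrightarrow> psi m \<le> psi n"
  unfolding psi_def by (intro sum_mono2) (auto intro: mangoldt_nonneg)

text \<open>By Legendre's formula the central binomial coefficient has logarithm \<Sum>
  \<open>mangoldt d * ((2 * n) div d - 2 * (n div d))\<close>. No coefficient is negative, and those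
  with \<open>n < d \<le> 2 * n\<close> are at least 1; the binomial bound
  \<open>2 ^ (2 * n)\<close> finishes.\<close>

lemma psi_double: "psi (2 * n) - psi n \<le> 2 * real n * ln 2"
proof -
  have "psi (2 * n) - psi n = (\<Sum>d=1..2*n. mangoldt d * of_bool (n < d))"
  proof -
    have "psi (2 * n) = (\<Sum>d=1..2*n. mangoldt d * of_bool (n < d)) + (\<Sum>d=1..2*n. mangoldt d * of_bool (d \<le> n))"
      unfolding psi_def by (subst sum.distrib[symmetric]) (auto intro!: sum.cong)
    also have "(\<Sum>d=1..2*n. mangoldt d * of_bool (d \<le> n)) = psi n"
      unfolding psi_def by (intro sum.mono_neutral_cong_right) auto
    finally show ?thesis by simp
  qed
  also have "\<dots> \<le> (\<Sum>d=1..2*n. mangoldt d * (real ((2 * n) div d) - 2 * real (n div d)))"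
  proof (intro sum_mono mult_left_mono mangoldt_nonneg)
    fix d assume d: "d \<in> {1..2*n}"
    have "2 * (n div d) \<le> (2 * n) div d"
      using d by (simp add: less_eq_div_iff_mult_less_eq)
    moreover have "n < d \<Longrightarrow> 1 \<le> (2 * n) div d" 
      using d by (simp add: less_eq_div_iff_mult_less_eq)
    moreover have "n < d \<Longrightarrow> n div d = 0" by simp
    ultimately show "of_bool (n < d) \<le> real ((2 * n) div d) - 2 * real (n div d)"
      by (cases "n < d") auto
  qed
  also have "\<dots> = (\<Sum>d=1..2*n. mangoldt d * real ((2 * n) div d)) - 2 * (\<Sum>d=1..2*n. mangoldt d * real (n div d))"
    by (simp add: algebra_simps sum_subtractf sum_distrib_left)
  also have "(\<Sum>d=1..2*n. mangoldt d * real (n div d)) = ln (fact n)"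
    unfolding ln_fact_mangoldt by (intro sum.mono_neutral_right) auto
  also have "(\<Sum>d=1..2*n. mangoldt d * real ((2 * n) div d)) = ln (fact (2 * n))"
    unfolding ln_fact_mangoldt by simp
  also have "ln (fact (2 * n)) - 2 * ln (fact n) = ln (real ((2 * n) choose n))"
  proof -
    have "real ((2 * n) choose n) = fact (2 * n) / (fact n * fact n)"
      by (subst binomial_fact) auto
    thus ?thesis by (simp add: ln_div ln_mult)
  qed
  also have "\<dots> \<le> ln (2 ^ (2 * n))"
    by (metis binomial_le_pow2 binomial_eq_0_iff ln_mono not_gr_zero numeral_power_le_of_nat_cancel_iff
        of_nat_0_less_iff of_nat_le_numeral_power_cancel_iff le_add2 mult_2 not_less zero_less_power zero_less_numeral)
  also have "\<dots> = 2 * real n * ln 2"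
    by (simp add: ln_realpow)
  finally show ?thesis .
qed

lemma psi_le: "psi n \<le> 6 * real n"
proof (induction n rule: less_induct)
  case (less n)
  show ?case
  proof (cases "n \<le> 1")
    case True
    hence "n = 0 \<or> n = 1" by auto
    thus ?thesis by (auto simp: psi_def)
  next
    case False
    \<comment> \<open>Halving with rounding up keeps \<open>n \<le> 2 * m\<close>; the constant 6 is
      generous enough to absorb the surplus \<open>2 * m \<le> n + 1\<close> from
      \<open>n = 2\<close> on.\<close>
    define m where "m = (n + 1) div 2"
    have m: "m < n" "n \<le> 2 * m" "2 * m \<le> n + 1" using False unfolding m_def by auto
    have "psi n \<le> psi (2 * m)" by (rule psi_mono) fact
    also have "\<dots> \<le> psi m + 2 * real m * ln 2" using psi_double[of m] by simp
    also have "\<dots> \<le> 6 * real m + 2 * real m * (25/36)"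
      using less.IH[OF m(1)] ln2_le_25_over_36 by (intro add_mono mult_left_mono) auto
    also have "\<dots> \<le> 6 * real n" using m False by linarith
    finally show ?thesis .
  qed
qed

lemma ln_fact_ge: "real n * ln (real n) - real n \<le> ln (fact n)"
proof (induction n)
  case (Suc n)
  show ?case
  proof (cases "n = 0")
    case False
    have "ln ((real n + 1) / real n) \<le> (real n + 1) / real n - 1"
      using False by (intro ln_le_minus_one) auto
    hence "real n * (ln (real n + 1) - ln (real n)) \<le> 1"
      using False by (simp add: ln_div field_simps)
    moreover have "ln (fact (Suc n) :: real) = ln (real n + 1) + ln (fact n)"
      unfolding fact_Suc by (subst ln_mult) (auto simp: add_ac)
    ultimately show ?thesis using Suc by (simp add: algebra_simps)
  qed auto
qed auto

lemma ln_fact_le: "ln (fact n) \<le> real n * ln (real n)"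
proof -
  have "(fact n :: real) \<le> real n ^ n" using fact_le_power[of n] by (simp add: of_nat_le_iff)
  hence "ln (fact n :: real) \<le> ln (real n ^ n)" by (intro ln_mono) auto
  thus ?thesis by (cases "n = 0") (auto simp: ln_realpow)
qed

section \<open>Mertens' first theorem\<close>

text \<open>Replacing \<open>n div d\<close> by \<open>n / d\<close> in Legendre's formula costs at
  most \<open>psi n\<close>, whence the 6 in the upper bound. For the lower bound the rounding has
  the right sign, and the 1 comes from Stirling's formula.\<close>

lemma mangoldt_over_sum:
  assumes "n > 0"
  shows "(\<Sum>d=1..n. mangoldt d / real d) \<le> ln (real n) + 6"
    and "(\<Sum>d=1..n. mangoldt d / real d) \<ge> ln (real n) - 1"
proof -
  have "real n * (\<Sum>d=1..n. mangoldt d / real d) - psi n = (\<Sum>d=1..n. mangoldt d * (real n / real d - 1))"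
    by (simp add: psi_def sum_distrib_left algebra_simps sum_subtractf)
  also have "\<dots> \<le> (\<Sum>d=1..n. mangoldt d * real (n div d))"
  proof (intro sum_mono mult_left_mono mangoldt_nonneg)
    fix d assume "d \<in> {1..n}"
    show "real n / real d - 1 \<le> real (n div d)"
      using floor_divide_of_nat_eq[of n d, where 'a=real] by linarith
  qed
  also have "\<dots> \<le> real n * ln (real n)" using ln_fact_le[of n] unfolding ln_fact_mangoldt .
  finally have "real n * (\<Sum>d=1..n. mangoldt d / real d) \<le> real n * (ln (real n) + 6)"
    using psi_le[of n] by (simp add: algebra_simps)
  thus "(\<Sum>d=1..n. mangoldt d / real d) \<le> ln (real n) + 6" using assms by simp
  have "real n * (ln (real n) - 1) \<le> ln (fact n)" using ln_fact_ge[of n] by (simp add: algebra_simps)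
  also have "\<dots> \<le> (\<Sum>d=1..n. mangoldt d * (real n / real d))"
    unfolding ln_fact_mangoldt
    by (intro sum_mono mult_left_mono mangoldt_nonneg of_nat_div_le_of_nat)
  also have "\<dots> = real n * (\<Sum>d=1..n. mangoldt d / real d)"
    by (simp add: sum_distrib_left algebra_simps)
  finally show "(\<Sum>d=1..n. mangoldt d / real d) \<ge> ln (real n) - 1" using assms by simp
qed

lemma sum_ln_over_square:
  "(\<Sum>k=2..n. ln (real k) / (real k * (real k - 1))) \<le> 2"
proof -
  \<comment> \<open>Strengthened for the induction: the subtracted term is the integral tail
    \<open>(ln n + 1) / n\<close> of \<open>ln x / x\<^sup>2\<close>, enlarged by
    \<open>1 / n\<close>, and its decrements dominate the summands.\<close>
  have "(\<Sum>k=2..n. ln (real k) / (real k * (real k - 1))) \<le> 2 - (ln (real n) + 2) / real n" if "n \<ge> 1"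
    using that
  proof (induction n rule: nat_induct_at_least)
    case (Suc n)
    define x where "x = real n"
    have x: "x \<ge> 1" using Suc by (simp add: x_def)
    have "ln ((x + 1) / x) \<le> (x + 1) / x - 1" using x by (intro ln_le_minus_one) auto
    hence "ln (x + 1) - ln x \<le> 1 / x" using x by (simp add: ln_div field_simps)
    hence "(x + 1) * (ln (x + 1) - ln x) \<le> (x + 1) * (1 / x)" using x by (intro mult_left_mono) auto
    also have "\<dots> \<le> 2" using x by (simp add: field_simps)
    finally have *: "(x + 1) * (ln (x + 1) - ln x) \<le> 2" .
    have "ln (x + 1) / ((x + 1) * x) \<le> (ln x + 2) / x - (ln (x + 1) + 2) / (x + 1)"
    proof -
      have "(ln x + 2) / x - (ln (x + 1) + 2) / (x + 1) - ln (x + 1) / ((x + 1) * x)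
          = (2 - (x + 1) * (ln (x + 1) - ln x)) / (x * (x + 1))"
        using x by (simp add: divide_simps) (simp add: algebra_simps)
      also have "\<dots> \<ge> 0" using x * by (intro divide_nonneg_nonneg) auto
      finally show ?thesis by simp
    qed
    thus ?case using Suc by (simp add: x_def add_ac)
  qed auto
  moreover have "(ln (real n) + 2) / real n \<ge> 0" if "n \<ge> 1"
    using that by simp
  ultimately show ?thesis by (cases "n = 0") (auto simp: not_less_eq_eq Suc_le_eq intro: order.trans)
qed

lemma geometric_tail_le:
  fixes p :: nat assumes "p \<ge> 2"
  shows "(\<Sum>a=2..n. 1 / real p ^ a) \<le> 1 / (real p * (real p - 1))"
proof -
  have "(\<Sum>a=2..n. 1 / real p ^ a) \<le> 1 / (real p * (real p - 1)) - 1 / (real p ^ n * (real p - 1))" if "n \<ge> 1"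
    using that
  proof (induction n rule: nat_induct_at_least)
    case (Suc n)
    have "1 / real p ^ Suc n = 1 / (real p ^ n * (real p - 1)) - 1 / (real p ^ Suc n * (real p - 1))"
      using assms by (simp add: divide_simps)
    thus ?case using Suc by simp
  qed auto
  moreover have "1 / (real p ^ n * (real p - 1)) \<ge> 0" using assms by simp
  moreover have "1 / (real p * (real p - 1)) \<ge> 0" using assms by simp
  ultimately show ?thesis by (cases "n = 0") (auto simp: not_less_eq_eq Suc_le_eq intro: order.trans)
qed

text \<open>The proper prime powers contribute at most \<Sum>
  \<open>ln p / (p * (p - 1)) \<le> 2\<close>, which turns the lower constant 1 for
  \<open>mangoldt\<close> into 3.\<close>

lemma mertens1_nat:
  assumes "n > 0"
  shows "(\<Sum>p | prime p \<and> p \<le> n. ln (real p) / real p) \<le> ln (real n) + 6"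
    and "(\<Sum>p | prime p \<and> p \<le> n. ln (real p) / real p) \<ge> ln (real n) - 3"
proof -
  let ?P = "{p. prime p \<and> p \<le> n}"
  have fin: "finite ?P" by simp
  have sub: "?P \<subseteq> {1..n}" using prime_ge_1_nat by auto
  have eq: "(\<Sum>p\<in>?P. ln (real p) / real p) = (\<Sum>p\<in>?P. mangoldt p / real p)"
    by (intro sum.cong) auto
  also have "\<dots> \<le> (\<Sum>d=1..n. mangoldt d / real d)"
    by (intro sum_mono2 sub) (auto intro: divide_nonneg_nonneg mangoldt_nonneg)
  finally show "(\<Sum>p\<in>?P. ln (real p) / real p) \<le> ln (real n) + 6"
    using mangoldt_over_sum(1)[OF assms] by simp
  have "(\<Sum>d=1..n. mangoldt d / real d) = (\<Sum>p\<in>?P. mangoldt p / real p) + (\<Sum>d\<in>{1..n}-?P. mangoldt d / real d)"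
    by (subst sum.subset_diff[OF sub]) auto
  also have "(\<Sum>d\<in>{1..n}-?P. mangoldt d / real d) = (\<Sum>d\<in>{d\<in>{1..n}-?P. primepow d}. mangoldt d / real d)"
    by (intro sum.mono_neutral_right) (auto simp: mangoldt_def)
  also have "\<dots> \<le> (\<Sum>d\<in>(\<lambda>(p,a). p ^ a) ` (?P \<times> {2..n}). mangoldt d / real d)"
  proof (intro sum_mono2)
    show "{d\<in>{1..n}-?P. primepow d} \<subseteq> (\<lambda>(p,a). p ^ a) ` (?P \<times> {2..n})"
    proof
      fix d assume d: "d \<in> {d\<in>{1..n}-?P. primepow d}"
      then obtain p a where pa: "prime p" "a > 0" "d = p ^ a" by (auto simp: primepow_def)
      have "a \<noteq> 1" using pa d by auto
      have "p ^ 1 \<le> p ^ a" using pa prime_gt_0_nat by (intro power_increasing) (auto simp: Suc_le_eq)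
      hence "p \<le> n" using pa d by auto
      have "a < p ^ a" using prime_gt_1_nat[OF pa(1)] power_gt_expt[of p a] by simp
      hence "a \<le> n" using pa d by auto
      show "d \<in> (\<lambda>(p,a). p ^ a) ` (?P \<times> {2..n})"
        using pa \<open>a \<noteq> 1\<close> \<open>p \<le> n\<close> \<open>a \<le> n\<close> by (auto intro!: image_eqI[of _ _ "(p,a)"])
    qed
  qed (auto intro: divide_nonneg_nonneg mangoldt_nonneg)
  also have "\<dots> \<le> (\<Sum>(p,a)\<in>?P \<times> {2..n}. mangoldt (p ^ a) / real (p ^ a))"
    by (rule order.trans[OF sum_image_le])
       (auto simp: o_def case_prod_unfold simp del: mangoldt_primepow' intro: divide_nonneg_nonneg mangoldt_nonneg)
  also have "\<dots> = (\<Sum>p\<in>?P. ln (real p) * (\<Sum>a=2..n. 1 / real p ^ a))"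
    by (subst sum.cartesian_product[symmetric], unfold sum_distrib_left, intro sum.cong refl) auto
  also have "\<dots> \<le> (\<Sum>p\<in>?P. ln (real p) * (1 / (real p * (real p - 1))))"
    by (intro sum_mono mult_left_mono geometric_tail_le) (auto intro: prime_ge_2_nat dest: prime_ge_1_nat)
  also have "\<dots> \<le> (\<Sum>p=2..n. ln (real p) * (1 / (real p * (real p - 1))))"
  proof (intro sum_mono2)
    show "?P \<subseteq> {2..n}" using prime_ge_2_nat by auto
    fix k assume "k \<in> {2..n} - ?P"
    thus "0 \<le> ln (real k) * (1 / (real k * (real k - 1)))"
      by (intro mult_nonneg_nonneg divide_nonneg_nonneg) auto
  qed auto
  also have "\<dots> \<le> 2" using sum_ln_over_square[of n] by (simp only: times_divide_eq_right mult_1_right)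
  finally show "(\<Sum>p\<in>?P. ln (real p) / real p) \<ge> ln (real n) - 3"
    using mangoldt_over_sum(2)[OF assms] eq by linarith
qed

lemma finite_primes_le: "finite {p. prime p \<and> real p \<le> x}"
proof (rule finite_subset)
  show "{p. prime p \<and> real p \<le> x} \<subseteq> {..nat \<lfloor>x\<rfloor>}" by (auto simp: le_nat_floor)
qed auto

lemma primes_le_real: "x \<ge> 0 \<Longrightarrow> {p. prime p \<and> real p \<le> x} = {p. prime p \<and> p \<le> nat \<lfloor>x\<rfloor>}"
  by (auto simp: le_nat_floor) (meson le_floor_iff of_nat_floor order_trans of_nat_le_iff)

lemma ln_floor_bounds:
  assumes "x \<ge> 1"
  shows "ln (real (nat \<lfloor>x\<rfloor>)) \<le> ln x" "ln (real (nat \<lfloor>x\<rfloor>)) \<ge> ln x - 1"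
proof -
  have "real (nat \<lfloor>x\<rfloor>) = of_int \<lfloor>x\<rfloor>" using assms by simp
  moreover have "\<lfloor>x\<rfloor> \<ge> 1" using assms by simp
  ultimately have n: "real (nat \<lfloor>x\<rfloor>) \<ge> 1" "real (nat \<lfloor>x\<rfloor>) \<le> x" "x \<le> 2 * real (nat \<lfloor>x\<rfloor>)"
    using assms by linarith+
  show "ln (real (nat \<lfloor>x\<rfloor>)) \<le> ln x" using n by (intro ln_mono) auto
  have "ln x \<le> ln (2 * real (nat \<lfloor>x\<rfloor>))" using n assms by (intro ln_mono) auto
  also have "\<dots> = ln 2 + ln (real (nat \<lfloor>x\<rfloor>))" using n by (subst ln_mult) auto
  finally show "ln (real (nat \<lfloor>x\<rfloor>)) \<ge> ln x - 1" using ln2_le_25_over_36 by simp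
qed

lemma mertens1:
  assumes "x \<ge> 1"
  shows "(\<Sum>p | prime p \<and> real p \<le> x. ln (real p) / real p) \<le> ln x + 6"
    and "(\<Sum>p | prime p \<and> real p \<le> x. ln (real p) / real p) \<ge> ln x - 4"
proof -
  have n: "nat \<lfloor>x\<rfloor> > 0" using assms by linarith
  have eq: "{p. prime p \<and> real p \<le> x} = {p. prime p \<and> p \<le> nat \<lfloor>x\<rfloor>}"
    using assms by (intro primes_le_real) auto
  show "(\<Sum>p | prime p \<and> real p \<le> x. ln (real p) / real p) \<le> ln x + 6"
    unfolding eq using mertens1_nat(1)[OF n] ln_floor_bounds(1)[OF assms] by linarith
  show "(\<Sum>p | prime p \<and> real p \<le> x. ln (real p) / real p) \<ge> ln x - 4"
    unfolding eq using mertens1_nat(2)[OF n] ln_floor_bounds(2)[OF assms] by linarith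
qed

section \<open>Mertens' second theorem\<close>

lemma mertens2_nat:
  assumes "n \<ge> 2"
  shows "\<bar>(\<Sum>p | prime p \<and> p \<le> n. 1 / real p) - ln (ln (real n))\<bar> \<le> 40"
proof -
  define B where "B = (\<lambda>n::nat. \<Sum>p | prime p \<and> p \<le> n. 1 / real p)"
  define A where "A = (\<lambda>n::nat. \<Sum>p | prime p \<and> p \<le> n. ln (real p) / real p)"
  define E where "E = (\<lambda>n. A n - ln (real n))"
  have E: "E n \<le> 6" "E n \<ge> -6" if "n > 0" for n
    using mertens1_nat[OF that] by (auto simp: E_def A_def)
  have setSuc: "{p. prime p \<and> p \<le> Suc n} = (if prime (Suc n) then insert (Suc n) {p. prime p \<and> p \<le> n} else {p. prime p \<and> p \<le> n})" for n
    by (auto simp: le_Suc_eq)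
  have step: "B (Suc n) - B n = (A (Suc n) - A n) / ln (real (Suc n))" if "n \<ge> 1" for n
    using that unfolding A_def B_def setSuc by auto
  have init: "B 2 = 1 / 2" "A 2 = ln 2 / 2"
  proof -
    have "{p. prime p \<and> p \<le> (2::nat)} = {2}" by (auto dest: prime_ge_2_nat)
    thus "B 2 = 1 / 2" "A 2 = ln 2 / 2" unfolding A_def B_def by auto
  qed
  have ln2: "ln 2 \<ge> (2/3::real)" "ln 2 \<le> (25/36::real)" by (rule ln2_ge_two_thirds ln2_le_25_over_36)+
  have lnln2: "ln (ln 2) \<le> (0::real)" "ln (ln 2) \<ge> (-1::real)"
  proof -
    show "ln (ln 2) \<le> (0::real)" using ln2 by simp
    have "exp (-1::real) \<le> 1 / 2" using exp_ge_add_one_self[of 1] by (simp add: exp_minus field_simps)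
    hence "exp (-1::real) \<le> ln 2" using ln2 by linarith
    thus "ln (ln 2) \<ge> (-1::real)" using ln2 by (subst ln_ge_iff) auto
  qed
  \<comment> \<open>Abel summation in incremental form: the terms in \<open>E n\<close> are those of the summation by parts,
    and the multiples of \<open>1 / ln n\<close> absorb its error telescopically.\<close>
  have main: "B n \<le> ln (ln (real n)) + E n / ln (real n) - 6 / ln (real n) + 20
     \<and> B n \<ge> ln (ln (real n)) + E n / ln (real n) + 7 / ln (real n) - 20"
    using assms
  proof (induction n rule: nat_induct_at_least)
    case base
    have "E 2 / ln 2 = - 1 / 2" unfolding E_def init using ln2 by (simp add: field_simps)
    moreover have "6 / ln 2 \<le> (9 :: real)" "7 / ln 2 \<le> (21 / 2 :: real)"
      using ln2 by (simp_all add: divide_le_eq)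
    moreover have "0 \<le> 6 / (ln 2 :: real)" using ln2 by simp
    ultimately have "B 2 \<le> ln (ln 2) + E 2 / ln 2 - 6 / ln 2 + 20"
        and "B 2 \<ge> ln (ln 2) + E 2 / ln 2 + 7 / ln 2 - 20"
      using init lnln2 by linarith+
    thus ?case by simp
  next
    case (Suc n)
    define a where "a = ln (real n)"
    define b where "b = ln (real (Suc n))"
    have a: "a > 0" "a < b" using Suc unfolding a_def b_def by auto
    have "ln ((real n + 1) / real n) \<le> (real n + 1) / real n - 1" using Suc by (intro ln_le_minus_one) auto
    also have "\<dots> \<le> 1" using Suc by (simp add: field_simps)
    finally have ba: "b - a \<le> 1" using Suc unfolding a_def b_def by (simp add: ln_div add_ac)
    have l1: "ln b - ln a \<le> (b - a) / a"
      using ln_le_minus_one[of "b / a"] a by (simp add: ln_div field_simps)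
    have l2: "ln b - ln a \<ge> (b - a) / b"
      using ln_le_minus_one[of "a / b"] a by (simp add: ln_div field_simps)
    have d: "1 / a - 1 / b \<ge> 0" using a by (simp add: field_simps)
    have st: "B (Suc n) - B n = (b - a) / b + (E (Suc n) - E n) / b"
      using step[of n] Suc.hyps unfolding E_def a_def[symmetric] b_def[symmetric]
      by (simp add: add_divide_distrib[symmetric])
    have "(6 - E n) * (1 / a - 1 / b) \<ge> 0" using E[of n] Suc d by (intro mult_nonneg_nonneg) auto
    hence u: "- E n / b \<le> - E n / a + 6 / a - 6 / b" by (simp add: algebra_simps)
    have "(E n + 6) * (1 / a - 1 / b) \<ge> 0" using E[of n] Suc d by (intro mult_nonneg_nonneg) auto
    hence v: "- E n / b \<ge> - E n / a - 6 / a + 6 / b" by (simp add: algebra_simps)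
    \<comment> \<open>The lower bound needs the increment \<open>(b - a) / a\<close> where summation
      by parts supplies \<open>(b - a) / b\<close>. The difference is at most
      \<open>1 / a - 1 / b\<close>, which is why the lower bound carries 7 in place of 6.\<close>
    have "(b - a) * (b - a) \<le> (b - a) * 1" using a ba by (intro mult_left_mono) auto
    moreover have "(1 / a - 1 / b) + (b - a) / b - (b - a) / a = ((b - a) * 1 - (b - a) * (b - a)) / (a * b)"
      using a by (simp add: divide_simps) (simp add: algebra_simps)
    moreover have "a * b > 0" using a by simp
    ultimately have w: "(b - a) / a \<le> (1 / a - 1 / b) + (b - a) / b"
      by (metis diff_ge_0_iff_ge divide_nonneg_pos)
    show ?case using st u v w l1 l2 Suc.IH unfolding a_def[symmetric] b_def[symmetric]
      by (auto simp: diff_divide_distrib)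
  qed
  have "ln 2 \<le> ln (real n)" using assms by (intro ln_mono) auto
  hence ln_n: "ln (real n) \<ge> 2/3" using ln2 by linarith
  have bd: "\<bar>E n / ln (real n)\<bar> \<le> 9"
  proof -
    have "\<bar>E n\<bar> \<le> 6" using E[of n] assms by auto
    also have "\<dots> \<le> 9 * ln (real n)" using ln_n by simp
    finally show ?thesis using ln_n by (simp add: field_simps)
  qed
  have "0 \<le> 6 / ln (real n)" "0 \<le> 7 / ln (real n)" using ln_n by auto
  thus ?thesis using main bd unfolding B_def by linarith
qed

lemma mertens2:
  assumes "x \<ge> 2"
  shows "\<bar>(\<Sum>p | prime p \<and> real p \<le> x. 1 / real p) - ln (ln x)\<bar> \<le> 42"
proof -
  define n where "n = nat \<lfloor>x\<rfloor>"
  have n: "n \<ge> 2" "real n \<le> x" "x \<le> real n + 1" using assms unfolding n_def by linarith+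
  have l: "ln (real n) \<le> ln x" "ln x \<le> ln (real n) + 1"
    using ln_floor_bounds[of x] assms unfolding n_def by auto
  have "ln 2 \<le> ln (real n)" using n by (intro ln_mono) auto
  hence l2: "ln (real n) \<ge> 2 / 3" using ln2_ge_two_thirds by linarith
  have "ln (ln (real n)) \<le> ln (ln x)" by (rule ln_mono) (use l l2 in linarith)+
  moreover have "ln (ln x) \<le> ln (ln (real n)) + 2"
  proof -
    have "ln (ln x / ln (real n)) \<le> ln x / ln (real n) - 1" using l l2 by (intro ln_le_minus_one) auto
    also have "\<dots> \<le> 2" using l l2 by (simp add: field_simps)
    finally show ?thesis using l l2 by (simp add: ln_div)
  qed
  moreover have "{p. prime p \<and> real p \<le> x} = {p. prime p \<and> p \<le> n}"
    unfolding n_def using assms by (intro primes_le_real) auto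
  ultimately show ?thesis using mertens2_nat[OF n(1)] by simp
qed

section \<open>Numbers with few prime factors\<close>

lemma prod_primes_dvd:
  fixes n :: nat
  assumes "finite A" "\<And>p. p \<in> A \<Longrightarrow> prime p \<and> p dvd n"
  shows "\<Prod>A dvd n"
  using assms
proof (induction A)
  case (insert p A)
  have "coprime p (\<Prod>A)"
    using insert by (intro prod_coprime_right) (metis insertCI primes_coprime)
  thus ?case using insert by (auto intro!: divides_mult)
qed auto

lemma squarefree_eq_prod_primes:
  fixes n :: nat
  assumes "squarefree n"
  shows "n = \<Prod>(prime_factors n)"
proof -
  have "n > 0" using assms by (cases "n = 0") auto
  have "n = (\<Prod>p\<in>prime_factors n. p ^ multiplicity p n)"
    by (rule prime_factorization_nat) fact
  also have "\<dots> = (\<Prod>p\<in>prime_factors n. p)"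
  proof (intro prod.cong refl)
    fix p assume p: "p \<in> prime_factors n"
    have "multiplicity p n \<le> 1"
      using assms p \<open>n > 0\<close> by (auto simp: squarefree_factorial_semiring'' )
    moreover have "multiplicity p n > 0" using p by (auto simp: prime_factors_multiplicity)
    ultimately have "multiplicity p n = 1" by simp
    thus "p ^ multiplicity p n = p" by simp
  qed
  finally show ?thesis .
qed

lemma prod_one_plus:
  fixes f :: "'a \<Rightarrow> real"
  assumes "finite P"
  shows "(\<Sum>A\<in>Pow P. \<Prod>p\<in>A. f p) = (\<Prod>p\<in>P. 1 + f p)"
  using prod_add[OF assms, of f "\<lambda>_. 1"] by (simp add: add.commute)

lemma prod_one_plus_le_exp:
  fixes f :: "'a \<Rightarrow> real"
  assumes "finite P" "\<And>p. p \<in> P \<Longrightarrow> f p \<ge> 0"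
  shows "(\<Prod>p\<in>P. 1 + f p) \<le> exp (\<Sum>p\<in>P. f p)"
  using assms by (subst exp_sum) (auto intro!: prod_mono)

lemma sum_inverse_squares_le: "(\<Sum>e=1..n. 1 / real e ^ 2) \<le> 2"
proof -
  have "(\<Sum>e=1..n. 1 / real e ^ 2) \<le> 2 - 1 / real n" if "n \<ge> 1"
    using that
  proof (induction n rule: nat_induct_at_least)
    case (Suc n)
    have "1 / (real n + 1) ^ 2 \<le> 1 / (real n * (real n + 1))"
      using Suc by (intro divide_left_mono) (auto simp: power2_eq_square)
    also have "\<dots> = 1 / real n - 1 / (real n + 1)" using Suc by (simp add: divide_simps)
    finally show ?case using Suc by (simp add: add_ac)
  qed auto
  thus ?thesis by (cases "n = 0") (auto simp: not_less_eq_eq Suc_le_eq intro: order.trans)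
qed

section \<open>Mean values of \<open>y ^ omega n\<close>\<close>

definition omega :: "nat \<Rightarrow> nat" where "omega n = card (prime_factors n)"

lemma omega_mono_dvd: "m dvd n \<Longrightarrow> n > 0 \<Longrightarrow> omega m \<le> omega n"
  unfolding omega_def by (intro card_mono dvd_prime_factors) auto

text \<open>An integer is determined by the prime set of its squarefree part together with its
  square part. As \<open>y \<le> 1\<close>, discarding the primes that occur only in the square
  increases the summand, and the sum is then dominated by an Euler product times \<Sum>
  \<open>1 / e\<^sup>2\<close>.\<close>

lemma sum_omega_over_le:
  assumes y: "0 \<le> y" "y \<le> 1" and N: "N \<ge> 2"
  shows "(\<Sum>n=1..N. y ^ omega n / real n) \<le> 2 * exp (42 * y) * ln (real N) powr y"
proof -
  define P where "P = {p. prime p \<and> real p \<le> real N}"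
  have finP: "finite P" unfolding P_def by (rule finite_primes_le)
  define g where "g = (\<lambda>(A, e). (\<Prod>p\<in>A. y / real p) * (1 / real e ^ 2))"
  define h where "h = (\<lambda>n::nat. (prime_factors (squarefree_part n), square_part n))"
  have sfp: "squarefree_part n = \<Prod>(prime_factors (squarefree_part n))" for n :: nat
    by (rule squarefree_eq_prod_primes) auto
  have inj: "inj_on h {1..N}"
  proof (rule inj_onI)
    fix m n assume "h m = h n"
    hence h: "prime_factors (squarefree_part m) = prime_factors (squarefree_part n)"
        "square_part m = square_part n"
      by (simp_all add: h_def)
    have "squarefree_part m = squarefree_part n" 
      by (rule trans[OF sfp[of m, unfolded h(1)] sfp[of n, symmetric]])
    with h(2) show "m = n" using squarefree_decomposition_unique by blast
  qed
  have sub: "h ` {1..N} \<subseteq> Pow P \<times> {1..N}"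
  proof
    fix x assume "x \<in> h ` {1..N}"
    then obtain n where n: "n \<in> {1..N}" "x = h n" by auto
    have d: "squarefree_part n dvd n" "square_part n dvd n"
      by (metis squarefree_decompose dvd_triv_left) (metis dvd_trans dvd_power square_part_square_dvd zero_less_numeral dvd_refl)
    have "square_part n \<le> n" using d n by (intro dvd_imp_le) auto
    moreover have "square_part n \<noteq> 0" using n by auto
    hence "1 \<le> square_part n" by linarith
    moreover have "p \<in> P" if "p \<in> prime_factors (squarefree_part n)" for p
    proof -
      have "p dvd n" "prime p" using that d by (auto intro: dvd_trans)
      thus ?thesis using n unfolding P_def by (auto dest!: dvd_imp_le)
    qed
    ultimately show "x \<in> Pow P \<times> {1..N}" using n unfolding h_def by auto
  qed
  have "(\<Sum>n=1..N. y ^ omega n / real n) \<le> (\<Sum>n=1..N. g (h n))"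
  proof (rule sum_mono)
    fix n assume n: "n \<in> {1..N}"
    define A where "A = prime_factors (squarefree_part n)"
    define e where "e = square_part n"
    have "squarefree_part n dvd n" by (metis squarefree_decompose dvd_triv_left)
    hence "card A \<le> omega n" using n unfolding A_def omega_def by (intro card_mono dvd_prime_factors) auto
    hence "y ^ omega n \<le> y ^ card A" using y by (intro power_decreasing)
    moreover have "real n = real (\<Prod>A) * real e ^ 2"
      using squarefree_decompose[of n] sfp[of n] unfolding A_def e_def
      by (metis of_nat_mult of_nat_power)
    moreover have "(\<Prod>p\<in>A. y / real p) = y ^ card A / real (\<Prod>A)"
      unfolding of_nat_prod by (simp add: prod_dividef)
    ultimately show "y ^ omega n / real n \<le> g (h n)"
      unfolding g_def h_def A_def[symmetric] e_def[symmetric]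
      by (auto intro!: divide_right_mono)
  qed
  also have "\<dots> = (\<Sum>x\<in>h ` {1..N}. g x)" by (subst sum.reindex[OF inj]) simp
  also have "\<dots> \<le> (\<Sum>x\<in>Pow P \<times> {1..N}. g x)"
    using sub finP y by (intro sum_mono2) (auto simp: g_def intro!: mult_nonneg_nonneg divide_nonneg_nonneg prod_nonneg)
  also have "\<dots> = (\<Sum>A\<in>Pow P. \<Prod>p\<in>A. y / real p) * (\<Sum>e=1..N. 1 / real e ^ 2)"
    unfolding g_def by (simp add: sum_product sum.cartesian_product)
  also have "\<dots> \<le> exp (y * (ln (ln (real N)) + 42)) * 2"
  proof (rule mult_mono[OF _ sum_inverse_squares_le])
    have "(\<Sum>A\<in>Pow P. \<Prod>p\<in>A. y / real p) \<le> exp (\<Sum>p\<in>P. y / real p)"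
      unfolding prod_one_plus[OF finP] using y by (intro prod_one_plus_le_exp finP) auto
    also have "(\<Sum>p\<in>P. y / real p) = y * (\<Sum>p\<in>P. 1 / real p)" by (simp add: sum_distrib_left)
    also have "\<dots> \<le> y * (ln (ln (real N)) + 42)"
      using mertens2[of "real N"] N y unfolding P_def by (intro mult_left_mono) auto
    finally show "(\<Sum>A\<in>Pow P. \<Prod>p\<in>A. y / real p) \<le> exp (y * (ln (ln (real N)) + 42))" by simp
  qed (auto intro!: sum_nonneg)
  also have "\<dots> = 2 * exp (42 * y) * ln (real N) powr y"
    using N by (simp add: powr_def algebra_simps exp_add)
  finally show ?thesis .
qed

text \<open>Bounding 1 by \<open>N / n\<close> would lose a factor \<open>ln N\<close>. It is
  regained by weighting with \<open>ln N = ln n + ln (N / n)\<close>: the second part is at most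
  \<open>N / n\<close>, and in the first \<open>ln n\<close> is opened as a sum of
  \<open>mangoldt d\<close> over \<open>n = d * m\<close>. Since \<open>y \<le> 1\<close>, passing
  from \<open>omega (d * m)\<close> to \<open>omega m\<close> only increases the term, and
  Chebyshev's bound sums over \<open>d\<close>.\<close>

lemma sum_omega_le:
  assumes y: "0 \<le> y" "y \<le> 1" and N: "N \<ge> 2"
  shows "(\<Sum>n=1..N. y ^ omega n) \<le> 14 * exp (42 * y) * real N * ln (real N) powr (y - 1)"
proof -
  define S where "S = (\<Sum>n=1..N. y ^ omega n / real n)"
  have "ln (real N) * (\<Sum>n=1..N. y ^ omega n) = (\<Sum>n=1..N. y ^ omega n * ln (real n)) + (\<Sum>n=1..N. y ^ omega n * ln (real N / real n))"
    unfolding sum_distrib_left sum.distrib[symmetric]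
    by (intro sum.cong refl) (use N in \<open>auto simp: ln_div algebra_simps\<close>)
  also have "(\<Sum>n=1..N. y ^ omega n * ln (real N / real n)) \<le> (\<Sum>n=1..N. y ^ omega n * (real N / real n))"
  proof (intro sum_mono mult_left_mono)
    fix n assume "n \<in> {1..N}"
    thus "ln (real N / real n) \<le> real N / real n"
      using ln_le_minus_one[of "real N / real n"] by auto
  qed (use y in auto)
  also have "\<dots> = real N * S" unfolding S_def by (simp add: sum_distrib_left mult_ac)
  also have "(\<Sum>n=1..N. y ^ omega n * ln (real n)) = (\<Sum>n=1..N. \<Sum>d | d dvd n. y ^ omega n * mangoldt d)"
    by (intro sum.cong refl) (subst sum_distrib_left[symmetric], subst mangoldt_sum, auto)
  also have "\<dots> = (\<Sum>d=1..N. \<Sum>m=1..N div d. y ^ omega (d * m) * mangoldt d)"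
    by (rule sum_dvd_swap)
  also have "\<dots> \<le> (\<Sum>d=1..N. \<Sum>m=1..N div d. y ^ omega m * mangoldt d)"
    using y by (intro sum_mono mult_right_mono mangoldt_nonneg power_decreasing omega_mono_dvd) auto
  also have "\<dots> = (\<Sum>m=1..N. \<Sum>d=1..N div m. y ^ omega m * mangoldt d)"
  proof -
    have le: "b \<le> N" if "a * b \<le> N" "Suc 0 \<le> a" for a b
      using that by (metis dual_order.trans mult_le_mono1 mult_1 One_nat_def)
    have "{1..N div d} = {m\<in>{1..N}. d * m \<le> N}" if "d \<in> {1..N}" for d
      using that by (auto simp: less_eq_div_iff_mult_less_eq mult.commute intro: le)
    hence "(\<Sum>d=1..N. \<Sum>m=1..N div d. y ^ omega m * mangoldt d)
      = (\<Sum>d=1..N. \<Sum>m | m \<in> {1..N} \<and> d * m \<le> N. y ^ omega m * mangoldt d)"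
      by (intro sum.cong refl) auto
    also have "\<dots> = (\<Sum>m=1..N. \<Sum>d | d \<in> {1..N} \<and> d * m \<le> N. y ^ omega m * mangoldt d)"
      by (rule sum.swap_restrict) auto
    also have "\<dots> = (\<Sum>m=1..N. \<Sum>d=1..N div m. y ^ omega m * mangoldt d)"
    proof (intro sum.cong refl)
      fix m assume "m \<in> {1..N}"
      thus "{d. d \<in> {1..N} \<and> d * m \<le> N} = {1..N div m}"
        by (auto simp: less_eq_div_iff_mult_less_eq mult.commute intro: le)
    qed
    finally show ?thesis .
  qed
  also have "\<dots> = (\<Sum>m=1..N. y ^ omega m * psi (N div m))"
    unfolding psi_def by (simp add: sum_distrib_left)
  also have "\<dots> \<le> (\<Sum>m=1..N. y ^ omega m * (6 * (real N / real m)))"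
  proof (intro sum_mono mult_left_mono)
    fix m assume "m \<in> {1..N}"
    show "psi (N div m) \<le> 6 * (real N / real m)"
      using psi_le[of "N div m"] of_nat_div_le_of_nat[of N m, where 'a=real] by linarith
  qed (use y in auto)
  also have "\<dots> = 6 * real N * S" unfolding S_def by (simp add: sum_distrib_left mult_ac)
  finally have "ln (real N) * (\<Sum>n=1..N. y ^ omega n) \<le> 7 * real N * S" by (simp add: mult_ac)
  also have "\<dots> \<le> 7 * real N * (2 * exp (42 * y) * ln (real N) powr y)"
    using sum_omega_over_le[OF y N] unfolding S_def by (intro mult_left_mono) auto
  finally have "(\<Sum>n=1..N. y ^ omega n) \<le> 14 * exp (42 * y) * real N * (ln (real N) powr y / ln (real N))"
    using N by (simp add: field_simps)
  also have "ln (real N) powr y / ln (real N) = ln (real N) powr (y - 1)"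
    using N by (simp add: powr_diff)
  finally show ?thesis .
qed

text \<open>Rankin's trick: as \<open>k \<le> 1\<close>, each counted \<open>n\<close> has
  \<open>k powr (omega n - k * L) \<ge> 1\<close>. The base \<open>k\<close> is the optimal one,
  since it minimises \<open>y - k * ln y\<close>.\<close>

lemma card_omega_small_le:
  assumes k: "0 < k" "k \<le> 1" and N: "N \<ge> 2"
  shows "real (card {n\<in>{1..N}. real (omega n) \<le> k * ln (ln (real N))})
     \<le> 14 * exp (42 * k) * real N * ln (real N) powr (k - 1 - k * ln k)"
proof -
  define L where "L = ln (ln (real N))"
  have "real (card {n\<in>{1..N}. real (omega n) \<le> k * L}) = (\<Sum>n | n \<in> {1..N} \<and> real (omega n) \<le> k * L. 1)" by simp
  also have "\<dots> \<le> (\<Sum>n | n \<in> {1..N} \<and> real (omega n) \<le> k * L. k powr (- (k * L)) * k ^ omega n)"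
  proof (rule sum_mono)
    fix n assume "n \<in> {n. n \<in> {1..N} \<and> real (omega n) \<le> k * L}"
    hence "k powr 0 \<le> k powr (real (omega n) - k * L)"
      using k by (intro powr_mono') auto
    also have "\<dots> = k powr (- (k * L)) * k ^ omega n"
      using k by (simp add: powr_diff powr_minus powr_realpow divide_inverse mult.commute)
    finally show "1 \<le> k powr (- (k * L)) * k ^ omega n" using k by simp
  qed
  also have "\<dots> \<le> (\<Sum>n=1..N. k powr (- (k * L)) * k ^ omega n)"
    using k by (intro sum_mono2) auto
  also have "\<dots> = k powr (- (k * L)) * (\<Sum>n=1..N. k ^ omega n)" by (simp add: sum_distrib_left)
  also have "\<dots> \<le> k powr (- (k * L)) * (14 * exp (42 * k) * real N * ln (real N) powr (k - 1))"
    using k N by (intro mult_left_mono sum_omega_le) auto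
  also have "k powr (- (k * L)) = ln (real N) powr (- k * ln k)"
    using k N by (simp add: powr_def L_def mult_ac)
  also have "ln (real N) powr (- k * ln k) * (14 * exp (42 * k) * real N * ln (real N) powr (k - 1))
     = 14 * exp (42 * k) * real N * ln (real N) powr (k - 1 - k * ln k)"
    by (simp add: powr_add[symmetric] mult_ac)
  finally show ?thesis unfolding L_def .
qed

section \<open>The gcd form bounded from below\<close>

text \<open>For sets of primes this is the identity expressing a squarefree \<open>n\<close> as the
  sum of Euler's totient over its divisors.\<close>

lemma prod_prime_minus_one_sum:
  fixes B :: "nat set"
  assumes "finite B"
  shows "(\<Sum>A\<in>Pow B. \<Prod>p\<in>A. real p - 1) = (\<Prod>p\<in>B. real p)"
  using prod_one_plus[OF assms, of "\<lambda>p. real p - 1"] by simp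

text \<open>
  Duality: with \<open>W A\<close> the total weight of the multiples of \<open>\<Prod>A\<close>, the gcd form is at least
  \<open>\<Sum>A. (\<Prod>p\<in>A. p - 1) * (W A)\<^sup>2\<close>, to which Cauchy--Schwarz is applied with weights \<open>v ^ card A\<close>.
\<close>

lemma gcd_sum_lower:
  fixes w :: "nat \<Rightarrow> real"
  assumes w: "\<And>m. m \<in> {1..N} \<Longrightarrow> w m \<ge> 0"
  defines "P \<equiv> {p. prime p \<and> real p \<le> real N}"
  shows "(\<Sum>m=1..N. w m * (1 + v) ^ omega m)\<^sup>2
     \<le> (\<Prod>p\<in>P. 1 + v\<^sup>2 / (real p - 1)) * (\<Sum>m1=1..N. \<Sum>m2=1..N. w m1 * w m2 * real (gcd m1 m2))"
proof -
  have finP: "finite P" unfolding P_def by (rule finite_primes_le)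
  have pf: "prime_factors m \<subseteq> P" if "m \<in> {1..N}" for m
    using that unfolding P_def by (auto simp: prime_factors_dvd dest!: dvd_imp_le)
  define I where "I = (\<lambda>A (m::nat). of_bool (A \<subseteq> prime_factors m) :: real)"
  define W where "W = (\<lambda>A. \<Sum>m=1..N. w m * I A m)"
  \<comment> \<open>Euler's totient of \<open>\<Prod>A\<close> when \<open>A\<close> consists of
    primes.\<close>
  define \<Phi> where "\<Phi> = (\<lambda>A::nat set. \<Prod>p\<in>A. real p - 1)"
  have Phi: "\<Phi> A > 0" if "A \<in> Pow P" for A
    using that unfolding \<Phi>_def P_def by (intro prod_pos) (auto dest!: prime_gt_1_nat)
  have restr: "(\<Sum>A\<in>Pow P. F A * of_bool (A \<subseteq> B)) = (\<Sum>A\<in>Pow B. F A)" if "B \<subseteq> P" for F :: "nat set \<Rightarrow> real" and B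
    using finP that by (intro sum.mono_neutral_cong_right) auto
  have "(\<Sum>m=1..N. w m * (1 + v) ^ omega m) = (\<Sum>m=1..N. w m * (\<Sum>A\<in>Pow P. v ^ card A * I A m))"
  proof (intro sum.cong refl, goal_cases)
    case (1 m)
    have "(\<Sum>A\<in>Pow P. v ^ card A * I A m) = (\<Sum>A\<in>Pow (prime_factors m). \<Prod>p\<in>A. v)"
      unfolding I_def by (subst restr[OF pf[OF 1]]) simp
    also have "\<dots> = (1 + v) ^ omega m"
      by (subst prod_one_plus) (auto simp: omega_def)
    finally show ?case by simp
  qed
  also have "\<dots> = (\<Sum>A\<in>Pow P. v ^ card A * W A)"
  proof -
    have "(\<Sum>m=1..N. w m * (\<Sum>A\<in>Pow P. v ^ card A * I A m)) = (\<Sum>A\<in>Pow P. \<Sum>m=1..N. w m * (v ^ card A * I A m))"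
      unfolding sum_distrib_left by (rule sum.swap)
    thus ?thesis unfolding W_def sum_distrib_left by (simp add: mult.left_commute)
  qed
  also have "\<dots> = (\<Sum>A\<in>Pow P. (v ^ card A / sqrt (\<Phi> A)) * (sqrt (\<Phi> A) * W A))"
  proof (intro sum.cong refl)
    fix A assume "A \<in> Pow P"
    hence "sqrt (\<Phi> A) > 0" using Phi by simp
    thus "v ^ card A * W A = (v ^ card A / sqrt (\<Phi> A)) * (sqrt (\<Phi> A) * W A)" by simp
  qed
  also have "\<dots>\<^sup>2 \<le> (\<Sum>A\<in>Pow P. (v ^ card A / sqrt (\<Phi> A))\<^sup>2) * (\<Sum>A\<in>Pow P. (sqrt (\<Phi> A) * W A)\<^sup>2)"
    by (rule Cauchy_Schwarz_ineq_sum)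
  also have "(\<Sum>A\<in>Pow P. (v ^ card A / sqrt (\<Phi> A))\<^sup>2) = (\<Prod>p\<in>P. 1 + v\<^sup>2 / (real p - 1))"
  proof -
    have "(\<Sum>A\<in>Pow P. (v ^ card A / sqrt (\<Phi> A))\<^sup>2) = (\<Sum>A\<in>Pow P. \<Prod>p\<in>A. v\<^sup>2 / (real p - 1))"
    proof (intro sum.cong refl)
      fix A assume A: "A \<in> Pow P"
      show "(v ^ card A / sqrt (\<Phi> A))\<^sup>2 = (\<Prod>p\<in>A. v\<^sup>2 / (real p - 1))"
        using Phi[OF A] by (simp add: power_divide prod_dividef \<Phi>_def flip: power_mult) (simp add: mult.commute)
    qed
    thus ?thesis by (simp add: prod_one_plus[OF finP])
  qed
  also have "(\<Sum>A\<in>Pow P. (sqrt (\<Phi> A) * W A)\<^sup>2) = (\<Sum>A\<in>Pow P. \<Phi> A * (W A * W A))"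
    using Phi by (intro sum.cong refl) (auto simp: power_mult_distrib power2_eq_square abs_of_pos)
  also have "\<dots> = (\<Sum>A\<in>Pow P. \<Sum>m1=1..N. \<Sum>m2=1..N. w m1 * w m2 * (\<Phi> A * (I A m1 * I A m2)))"
    unfolding W_def sum_product by (simp add: sum_distrib_left mult_ac)
  also have "\<dots> = (\<Sum>m1=1..N. \<Sum>m2=1..N. \<Sum>A\<in>Pow P. w m1 * w m2 * (\<Phi> A * (I A m1 * I A m2)))"
    by (subst sum.swap, intro sum.cong refl, rule sum.swap)
  also have "(\<Prod>p\<in>P. 1 + v\<^sup>2 / (real p - 1)) * \<dots>
    \<le> (\<Prod>p\<in>P. 1 + v\<^sup>2 / (real p - 1)) * (\<Sum>m1=1..N. \<Sum>m2=1..N. w m1 * w m2 * real (gcd m1 m2))"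
  proof (rule mult_left_mono, intro sum_mono, unfold sum_distrib_left[symmetric], intro mult_left_mono)
    fix m1 m2 assume m: "m1 \<in> {1..N}" "m2 \<in> {1..N}"
    define B where "B = prime_factors m1 \<inter> prime_factors m2"
    have "(\<Sum>A\<in>Pow P. \<Phi> A * (I A m1 * I A m2)) = (\<Sum>A\<in>Pow P. \<Phi> A * of_bool (A \<subseteq> B))"
      unfolding I_def B_def by (intro sum.cong refl) auto
    also have "\<dots> = (\<Prod>p\<in>B. real p)"
    proof -
      have "B \<subseteq> P" "finite B" using pf[OF m(1)] by (auto simp: B_def)
      thus ?thesis by (simp only: restr \<Phi>_def prod_prime_minus_one_sum)
    qed
    also have "\<dots> = real (\<Prod>B)" by simp
    \<comment> \<open>Divisibility only, since the gcd may contain prime powers; the radical already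
      suffices for a lower bound.\<close>
    also have "\<Prod>B dvd gcd m1 m2"
      by (rule prod_primes_dvd) (auto simp: B_def)
    hence "\<Prod>B \<le> gcd m1 m2"
      using m by (intro dvd_imp_le) auto
    hence "real (\<Prod>B) \<le> real (gcd m1 m2)"
      by (simp only: of_nat_le_iff)
    finally show "(\<Sum>A\<in>Pow P. \<Phi> A * (I A m1 * I A m2)) \<le> real (gcd m1 m2)" .
    show "0 \<le> w m1 * w m2" using w m by auto
  next
    show "0 \<le> (\<Prod>p\<in>P. 1 + v\<^sup>2 / (real p - 1))"
      unfolding P_def by (intro prod_nonneg) (auto dest!: prime_ge_1_nat)
  qed
  finally show ?thesis .
qed

section \<open>The lower bound\<close>

lemma prod_over_pred_primes_le:
  assumes N: "N \<ge> 2"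
  shows "(\<Prod>p | prime p \<and> real p \<le> real N. 1 + v\<^sup>2 / (real p - 1)) \<le> exp (46 * v\<^sup>2) * ln (real N) powr (v\<^sup>2)"
proof -
  define P where "P = {p. prime p \<and> real p \<le> real N}"
  have finP: "finite P" unfolding P_def by (rule finite_primes_le)
  have "(\<Prod>p\<in>P. 1 + v\<^sup>2 / (real p - 1)) \<le> exp (\<Sum>p\<in>P. v\<^sup>2 / (real p - 1))"
    using finP by (intro prod_one_plus_le_exp) (auto simp: P_def dest!: prime_ge_1_nat)
  \<comment> \<open>The constant 46 is the 42 of \<open>mertens2\<close> plus twice the bound 2 for
    the inverse squares.\<close>
  also have "(\<Sum>p\<in>P. v\<^sup>2 / (real p - 1)) \<le> (\<Sum>p\<in>P. v\<^sup>2 * (1 / real p + 2 * (1 / real p ^ 2)))"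
  proof (rule sum_mono)
    fix p assume "p \<in> P"
    hence p: "real p \<ge> 2" by (auto simp: P_def dest!: prime_ge_2_nat)
    have "1 / real p + 2 * (1 / real p ^ 2) - 1 / (real p - 1) = (real p - 2) / (real p ^ 2 * (real p - 1))"
      using p by (simp add: divide_simps power2_eq_square) (simp add: algebra_simps)
    moreover have "\<dots> \<ge> 0" using p by simp
    ultimately have "1 / (real p - 1) \<le> 1 / real p + 2 * (1 / real p ^ 2)" by linarith
    hence "v\<^sup>2 * (1 / (real p - 1)) \<le> v\<^sup>2 * (1 / real p + 2 * (1 / real p ^ 2))"
      by (intro mult_left_mono) auto
    thus "v\<^sup>2 / (real p - 1) \<le> v\<^sup>2 * (1 / real p + 2 * (1 / real p ^ 2))" by simp
  qed
  also have "\<dots> = v\<^sup>2 * ((\<Sum>p\<in>P. 1 / real p) + 2 * (\<Sum>p\<in>P. 1 / real p ^ 2))"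
    by (simp only: sum_distrib_left sum.distrib[symmetric])
  also have "\<dots> \<le> v\<^sup>2 * ((ln (ln (real N)) + 42) + 2 * 2)"
  proof (intro mult_left_mono add_mono)
    show "(\<Sum>p\<in>P. 1 / real p) \<le> ln (ln (real N)) + 42"
      using mertens2[of "real N"] N unfolding P_def by auto
    have "(\<Sum>p\<in>P. 1 / real p ^ 2) \<le> (\<Sum>e=1..N. 1 / real e ^ 2)"
      by (intro sum_mono2) (auto simp: P_def dest!: prime_gt_0_nat)
    thus "(\<Sum>p\<in>P. 1 / real p ^ 2) \<le> 2" using sum_inverse_squares_le[of N] by linarith
  qed auto
  also have "exp \<dots> = exp (46 * v\<^sup>2) * ln (real N) powr (v\<^sup>2)"
    using N by (simp add: powr_def algebra_simps exp_add)
  finally show ?thesis unfolding P_def by simp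
qed

text \<open>In \<open>d1\<close> stands the exponent of the count of integers with few prime
  factors; in \<open>d2\<close> the squared weight \<open>(1 + z) powr (k * ln (ln N))\<close> is
  set against the Euler product of exponent \<open>z\<^sup>2\<close> from Cauchy--Schwarz. As both
  equal \<open>d\<close>, the same power of \<open>ln N\<close> results wherever half of the weight
  lies.\<close>

lemma T0_lower:
  fixes z k d :: real
  assumes z: "0 < z" and k: "0 < k" "k \<le> 1"
    and d1: "d = 1 - k + k * ln k" and d2: "d = 2 * k * ln (1 + z) - z\<^sup>2"
  obtains c where "c > 0" "\<And>N. N \<ge> 3 \<Longrightarrow> c * ln (real N) powr d \<le> T0 N"
proof
  define C where "C = 14 * exp (42 * k) + exp (46 * z\<^sup>2)"
  have Cpos: "C > 0" unfolding C_def by (simp add: add_pos_pos)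
  show "1 / (4 * C) > 0" using Cpos by simp
  fix N :: nat assume N: "N \<ge> 3"
  define l where "l = ln (real N)"
  have l: "l > 0" unfolding l_def using N by simp
  show "1 / (4 * C) * ln (real N) powr d \<le> T0 N"
    unfolding T0_def
  proof (rule cINF_greatest)
    have "(\<lambda>_. 1) \<in> weights N" using N unfolding weights_def by auto
    thus "weights N \<noteq> {}" by blast
  next
    fix w assume w: "w \<in> weights N"
    hence w0: "w m \<ge> 0" if "m \<in> {1..N}" for m using that by (auto simp: weights_def)
    obtain m0 where m0: "m0 \<in> {1..N}" "w m0 \<noteq> 0" using w by (auto simp: weights_def)
    hence n1: "norm1 N w > 0"
      using w0 unfolding norm1_def by (intro sum_pos2[of _ m0]) (auto simp: less_le)
    define t where "t = (\<lambda>m1 m2. w m1 * w m2 * (real (gcd m1 m2) / (real m1 + real m2)))"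
    define Q where "Q = (\<Sum>m1=1..N. \<Sum>m2=1..N. t m1 m2)"
    define G where "G = (\<Sum>m1=1..N. \<Sum>m2=1..N. w m1 * w m2 * real (gcd m1 m2))"
    define S where "S = {n\<in>{1..N}. real (omega n) \<le> k * ln l}"
    have t0: "t m1 m2 \<ge> 0" if "m1 \<in> {1..N}" "m2 \<in> {1..N}" for m1 m2
      using w0[OF that(1)] w0[OF that(2)] unfolding t_def by (intro mult_nonneg_nonneg) auto
    have split: "norm1 N w = sum w S + sum w ({1..N} - S)"
      unfolding norm1_def by (subst sum.subset_diff[of S]) (auto simp: S_def)
    have low: "(sum w S)\<^sup>2 \<le> 2 * (14 * exp (42 * k)) * real N * l powr (- d) * Q"
    proof -
      have "(sum w S)\<^sup>2 = (\<Sum>m\<in>S. 1 * w m)\<^sup>2" by simp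
      also have "\<dots> \<le> (\<Sum>m\<in>S. 1\<^sup>2) * (\<Sum>m\<in>S. (w m)\<^sup>2)" by (rule Cauchy_Schwarz_ineq_sum)
      also have "\<dots> = real (card S) * (\<Sum>m\<in>S. (w m)\<^sup>2)" by simp
      also have "\<dots> \<le> (14 * exp (42 * k) * real N * l powr (k - 1 - k * ln k)) * (2 * Q)"
      proof (intro mult_mono)
        show "real (card S) \<le> 14 * exp (42 * k) * real N * l powr (k - 1 - k * ln k)"
          using card_omega_small_le[OF k, of N] N unfolding S_def l_def by simp
        have "(\<Sum>m\<in>S. (w m)\<^sup>2) \<le> (\<Sum>m=1..N. (w m)\<^sup>2)"
          by (intro sum_mono2) (auto simp: S_def)
        also have "\<dots> \<le> (\<Sum>m=1..N. 2 * (\<Sum>m2=1..N. t m m2))"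
        proof (rule sum_mono)
          fix m assume m: "m \<in> {1..N}"
          \<comment> \<open>On the diagonal \<open>gcd m m / (m + m)\<close> is 1/2.\<close>
          have "(w m)\<^sup>2 = 2 * t m m" using m unfolding t_def by (simp add: power2_eq_square)
          also have "t m m \<le> (\<Sum>m2=1..N. t m m2)"
            using m t0 by (intro member_le_sum) auto
          finally show "(w m)\<^sup>2 \<le> 2 * (\<Sum>m2=1..N. t m m2)" by simp
        qed
        also have "\<dots> = 2 * Q" unfolding Q_def by (simp add: sum_distrib_left)
        finally show "(\<Sum>m\<in>S. (w m)\<^sup>2) \<le> 2 * Q" .
      qed (auto intro!: sum_nonneg)
      also have "k - 1 - k * ln k = - d" by (simp add: d1)
      finally show ?thesis by (simp add: mult_ac)
    qed
    have GQ: "G \<le> 2 * real N * Q"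
      unfolding G_def Q_def sum_distrib_left
    proof (intro sum_mono)
      fix m1 m2 assume m: "m1 \<in> {1..N}" "m2 \<in> {1..N}"
      have "real (gcd m1 m2) * (real m1 + real m2) \<le> real (gcd m1 m2) * (2 * real N)"
        using m by (intro mult_left_mono) auto
      hence "real (gcd m1 m2) \<le> 2 * real N * (real (gcd m1 m2) / (real m1 + real m2))"
        using m by (simp add: le_divide_eq mult_ac)
      hence "(w m1 * w m2) * real (gcd m1 m2) \<le> (w m1 * w m2) * (2 * real N * (real (gcd m1 m2) / (real m1 + real m2)))"
        using w0 m by (intro mult_left_mono) auto
      thus "w m1 * w m2 * real (gcd m1 m2) \<le> 2 * real N * t m1 m2"
        unfolding t_def by (simp only: mult_ac)
    qed
    have high: "(sum w ({1..N} - S))\<^sup>2 \<le> 2 * exp (46 * z\<^sup>2) * real N * l powr (- d) * Q"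
    proof -
      have "l powr (k * ln (1 + z)) * sum w ({1..N} - S) = (\<Sum>m\<in>{1..N}-S. w m * l powr (k * ln (1 + z)))"
        by (simp only: sum_distrib_right mult.commute[of "l powr _"])
      also have "\<dots> \<le> (\<Sum>m\<in>{1..N}-S. w m * (1 + z) ^ omega m)"
      proof (intro sum_mono mult_left_mono)
        fix m assume m: "m \<in> {1..N} - S"
        have "l powr (k * ln (1 + z)) = (1 + z) powr (k * ln l)"
          using l z by (simp add: powr_def mult_ac)
        also have "\<dots> \<le> (1 + z) powr real (omega m)"
          using m z by (intro powr_mono) (auto simp: S_def)
        also have "\<dots> = (1 + z) ^ omega m" using z by (simp add: powr_realpow)
        finally show "l powr (k * ln (1 + z)) \<le> (1 + z) ^ omega m" .
      qed (use w0 in auto)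
      also have "\<dots> \<le> (\<Sum>m=1..N. w m * (1 + z) ^ omega m)"
        using w0 z by (intro sum_mono2) auto
      finally have "(l powr (k * ln (1 + z)) * sum w ({1..N} - S))\<^sup>2 \<le> (\<Sum>m=1..N. w m * (1 + z) ^ omega m)\<^sup>2"
        using w0 by (intro power_mono) (auto intro!: mult_nonneg_nonneg sum_nonneg)
      also have "\<dots> \<le> (\<Prod>p | prime p \<and> real p \<le> real N. 1 + z\<^sup>2 / (real p - 1)) * G"
        unfolding G_def using w0 by (rule gcd_sum_lower)
      also have "\<dots> \<le> (exp (46 * z\<^sup>2) * l powr (z\<^sup>2)) * (2 * real N * Q)"
        unfolding l_def using N w0 GQ
        by (intro mult_mono prod_over_pred_primes_le) (auto simp: G_def intro!: sum_nonneg mult_nonneg_nonneg)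
      finally have "(l powr (k * ln (1 + z)))\<^sup>2 * (sum w ({1..N} - S))\<^sup>2 \<le> (exp (46 * z\<^sup>2) * l powr (z\<^sup>2)) * (2 * real N * Q)"
        by (simp add: power_mult_distrib)
      \<comment> \<open>Dividing by the squared gain leaves the exponent
        \<open>z\<^sup>2 - 2 * k * ln (1 + z)\<close>, which is \<open>- d\<close>.\<close>
      hence "l powr (- (2 * k * ln (1 + z))) * ((l powr (k * ln (1 + z)))\<^sup>2 * (sum w ({1..N} - S))\<^sup>2)
         \<le> l powr (- (2 * k * ln (1 + z))) * ((exp (46 * z\<^sup>2) * l powr (z\<^sup>2)) * (2 * real N * Q))"
        by (intro mult_left_mono) auto
      also have "\<dots> = 2 * exp (46 * z\<^sup>2) * real N * (l powr (- (2 * k * ln (1 + z))) * l powr (z\<^sup>2)) * Q"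
        by (simp only: mult_ac)
      also have "l powr (- (2 * k * ln (1 + z))) * l powr (z\<^sup>2) = l powr (- d)"
        by (simp add: powr_add[symmetric] d2)
      also have "l powr (- (2 * k * ln (1 + z))) * ((l powr (k * ln (1 + z)))\<^sup>2 * (sum w ({1..N} - S))\<^sup>2)
          = (sum w ({1..N} - S))\<^sup>2"
        using l by (simp add: power2_eq_square powr_add[symmetric] mult.assoc[symmetric])
      finally show ?thesis .
    qed
    have "(norm1 N w)\<^sup>2 \<le> 2 * ((sum w S)\<^sup>2 + (sum w ({1..N} - S))\<^sup>2)"
      unfolding split using sum_squares_bound[of "sum w S" "sum w ({1..N} - S)"] by (simp add: power2_sum)
    also have "\<dots> \<le> 4 * C * real N * l powr (- d) * Q"
      using low high unfolding C_def by (simp add: algebra_simps)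
    finally have "(norm1 N w)\<^sup>2 * l powr d \<le> 4 * C * real N * l powr (- d) * Q * l powr d"
      by (intro mult_right_mono) auto
    also have "\<dots> = 4 * C * real N * Q" using l by (simp add: powr_minus)
    finally have "1 / (4 * C) * l powr d \<le> real N / (norm1 N w)\<^sup>2 * Q"
      using n1 Cpos by (simp add: field_simps)
    thus "1 / (4 * C) * ln (real N) powr d \<le> real N / (norm1 N w)\<^sup>2 *
        (\<Sum>m1=1..N. \<Sum>m2=1..N. w m1 * w m2 * (real (gcd m1 m2) / (real m1 + real m2)))"
      unfolding Q_def t_def l_def .
  qed
qed

section \<open>The exponent\<close>

lemma exponent_exists:
  obtains z k d :: real where
    "0 < z" "z < 1 / 2" "k = z + z\<^sup>2" "d = 1 - k + k * ln k" "d = 2 * k * ln (1 + z) - z\<^sup>2"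
    "\<bar>d - 0.16656\<bar> \<le> 0.000005"
proof -
  \<comment> \<open>\<open>z\<close> solves \<open>z (1 + z) ln (1 + 1/z) = 1 - z\<close>, which is the equality of the two expressions for \<open>d\<close>.\<close>
  define a b :: real where "a = 355302 / 1000000" and "b = 3553045 / 10000000"
  \<comment> \<open>For \<open>x\<close> near 1/3 the number \<open>1 + 1 / x\<close> is near 4.
    Splitting off \<open>ln 4\<close> leaves an argument close to 1, where two terms of the series
    used below are accurate enough.\<close>
  have ln4: "ln (4 * x / (1 + x)) = 2 * ln 2 - ln (1 + 1 / x)" if "x > 0" for x :: real
  proof -
    have "1 + 1 / x = (1 + x) / x" using that by (simp add: field_simps)
    moreover have "ln (4 :: real) = 2 * ln 2" using ln_realpow[of 2 2] by simp
    ultimately show ?thesis using that by (simp add: ln_div ln_mult)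
  qed
  have lower: "(\<Sum>k<n. 2 * ((x - 1) / (x + 1)) ^ (2 * k + 1) / real (2 * k + 1)) \<le> ln x" if "x > 1" for x :: real and n
    using ln_approx_bounds[of x n] that by auto
  have upper: "ln x \<le> (\<Sum>k<n. 2 * ((x - 1) / (x + 1)) ^ (2 * k + 1) / real (2 * k + 1)) +
      2 * (((x - 1) / (x + 1)) ^ (2 * n + 1) / (1 - ((x - 1) / (x + 1)) ^ 2) / real (2 * n + 1))" if "x > 1" for x :: real and n
    using ln_approx_bounds[of x n] that by auto
  have "(693147 / 1000000 :: real) \<le> (\<Sum>k<7. 2 * ((2 - 1) / (2 + 1)) ^ (2 * k + 1) / real (2 * k + 1))"
    by (simp add: lessThan_nat_numeral power_divide)
  hence ln2l: "693147 / 1000000 \<le> ln (2::real)" using lower[of 2 7] by simp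
  have "(\<Sum>k<7. 2 * ((2 - 1) / (2 + 1)) ^ (2 * k + 1) / real (2 * k + 1)) +
      2 * (((2 - 1) / (2 + 1)) ^ (2 * 7 + 1) / (1 - ((2 - 1) / (2 + 1)) ^ 2) / real (2 * 7 + 1)) \<le> (6931473 / 10000000 :: real)"
    by (simp add: lessThan_nat_numeral power_divide)
  hence ln2u: "ln (2::real) \<le> 6931473 / 10000000" using upper[of 2 7] by simp
  have "474827 / 10000000 \<le> ln (4 * a / (1 + a))"
    by (rule order.trans[OF _ lower[of _ 2]]) (simp_all add: a_def lessThan_nat_numeral power_divide)
  moreover have "ln (4 * a / (1 + a)) = 2 * ln 2 - ln (1 + 1 / a)"
    by (rule ln4) (simp add: a_def)
  ultimately have la: "ln (1 + 1 / a) \<le> 13388206/10000000" using ln2u by linarith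
  have "ln (4 * b / (1 + b)) \<le> 474885 / 10000000"
    by (rule order.trans[OF upper[of _ 2]]) (simp_all add: b_def lessThan_nat_numeral power_divide)
  moreover have "ln (4 * b / (1 + b)) = 2 * ln 2 - ln (1 + 1 / b)"
    by (rule ln4) (simp add: b_def)
  ultimately have lb: "ln (1 + 1 / b) \<ge> 13388049/10000000" using ln2l by linarith
  have l1a: "ln (1 + a) \<ge> 3040242/10000000"
    by (rule order.trans[OF _ lower[of _ 4]]) (simp_all add: a_def lessThan_nat_numeral power_divide)
  have l1b: "ln (1 + b) \<le> 3040262/10000000"
    by (rule order.trans[OF upper[of _ 4]]) (simp_all add: b_def lessThan_nat_numeral power_divide)
  define f where "f = (\<lambda>x::real. x * (1 + x) * ln (1 + 1 / x) - (1 - x))"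
  have "f a \<le> 0"
  proof -
    have "a * (1 + a) * ln (1 + 1 / a) \<le> a * (1 + a) * (13388206 / 10000000)"
      using la by (intro mult_left_mono) (auto simp: a_def)
    also have "\<dots> \<le> 1 - a" by (simp add: a_def)
    finally show ?thesis by (simp add: f_def)
  qed
  moreover have "0 \<le> f b"
  proof -
    have "1 - b \<le> b * (1 + b) * (13388049 / 10000000)" by (simp add: b_def)
    also have "\<dots> \<le> b * (1 + b) * ln (1 + 1 / b)"
      using lb by (intro mult_left_mono) (auto simp: b_def)
    finally show ?thesis by (simp add: f_def)
  qed
  moreover have "continuous_on {a..b} f"
  proof -
    have "x \<noteq> 0 \<and> 1 + 1 / x \<noteq> 0" if "x \<in> {a..b}" for x
    proof -
      have "x > 0" using that by (auto simp: a_def)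
      moreover from this have "1 + 1 / x > 0" by (intro add_pos_pos) auto
      ultimately show ?thesis by simp
    qed
    thus ?thesis unfolding f_def by (intro continuous_intros) auto
  qed
  ultimately obtain z where z: "a \<le> z" "z \<le> b" "f z = 0"
    using IVT'[of f a 0 b] by (auto simp: a_def b_def)
  have z0: "0 < z" "z < 1 / 2" using z by (auto simp: a_def b_def)
  define k where "k = z + z\<^sup>2"
  define d where "d = 2 * k * ln (1 + z) - z\<^sup>2"
  have kz: "k = z * (1 + z)" by (simp add: k_def power2_eq_square algebra_simps)
  have "1 + 1 / z = (1 + z) / z" using z0 by (simp add: field_simps)
  hence "ln (1 + 1 / z) = ln (1 + z) - ln z" using z0 by (simp add: ln_div)
  hence "k * (ln (1 + z) - ln z) = 1 - z" using z(3) by (simp add: f_def kz)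
  moreover have "ln k = ln z + ln (1 + z)" using z0 by (simp add: kz ln_mult)
  ultimately have dk: "d = 1 - k + k * ln k" by (simp add: d_def algebra_simps) (simp add: k_def)
  \<comment> \<open>Arranged so that all factors are nonnegative and each moves monotonically with
    \<open>z\<close> or with \<open>ln (1 + z)\<close>; the interval bounds can then be inserted
    factor by factor.\<close>
  have d_eq: "d = 2 * z * ln (1 + z) - z\<^sup>2 * (1 - 2 * ln (1 + z))"
    by (simp add: d_def k_def algebra_simps)
  have "ln (1 + a) \<le> ln (1 + z)" "ln (1 + z) \<le> ln (1 + b)"
    using z z0 by (auto simp: a_def)
  hence l: "ln (1 + z) \<ge> 3040242/10000000" "ln (1 + z) \<le> 3040262/10000000" using l1a l1b by linarith+
  have z2: "a * a \<le> z\<^sup>2" "z\<^sup>2 \<le> b * b"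
    using z z0 unfolding power2_eq_square by (intro mult_mono; simp add: a_def)+
  have "d \<le> 2 * b * (3040262/10000000) - (a * a) * (1 - 2 * (3040262/10000000))"
    unfolding d_eq using l z z0 z2 by (intro diff_mono mult_mono) (auto simp: a_def b_def)
  also have "\<dots> \<le> 0.166565" by (simp add: a_def b_def)
  finally have u: "d \<le> 0.166565" .
  have "0.166555 \<le> 2 * a * (3040242/10000000) - (b * b) * (1 - 2 * (3040242/10000000))"
    by (simp add: a_def b_def)
  also have "\<dots> \<le> d"
    unfolding d_eq using l z z0 z2 by (intro diff_mono mult_mono) (auto simp: a_def b_def)
  finally have "0.166555 \<le> d" .
  with u have "\<bar>d - 0.16656\<bar> \<le> 0.000005" unfolding abs_le_iff by simp
  thus ?thesis using that[of z k d] z0 k_def dk d_def by blast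
qed

section \<open>Primes in short windows and elementary symmetric sums\<close>

text \<open>The ratio \<open>exp 11\<close> exceeds the total error \<open>6 + 4\<close> in the two bounds of \<open>mertens1\<close>.\<close>

lemma prime_window_bounds:
  assumes x: "x \<ge> exp 11"
  defines "W \<equiv> {p. prime p \<and> x / exp 11 < real p \<and> real p \<le> x}"
  shows "x / (exp 11 * ln x) \<le> real (card W)"
    and "x > exp 11 \<Longrightarrow> real (card W) \<le> 21 * x / ln (x / exp 11)"
proof -
  have x0: "x > 0" using x by (rule less_le_trans[rotated]) simp
  have "ln (exp 11) \<le> ln x" using x by (intro ln_mono) auto
  hence lx: "ln x \<ge> 11" by simp
  have finW: "finite W" unfolding W_def by (rule finite_subset[OF _ finite_primes_le[of x]]) auto
  have x1: "x / exp 11 \<ge> 1" using x by simp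
  have split: "(\<Sum>p | prime p \<and> real p \<le> x. ln (real p) / real p)
      = (\<Sum>p | prime p \<and> real p \<le> x / exp 11. ln (real p) / real p) + (\<Sum>p\<in>W. ln (real p) / real p)"
  proof -
    have "x / exp 11 \<le> x" using x0 by (simp add: field_simps)
    hence "{p. prime p \<and> real p \<le> x} = {p. prime p \<and> real p \<le> x / exp 11} \<union> W"
      unfolding W_def by auto
    thus ?thesis by (simp only:) (rule sum.union_disjoint, auto simp: finite_primes_le finW, auto simp: W_def)
  qed
  have lnx: "ln (x / exp 11) = ln x - 11" using x0 by (simp add: ln_div)
  \<comment> \<open>The window has logarithmic length 11, and the two Mertens errors add up to
    10.\<close>
  have b: "(\<Sum>p\<in>W. ln (real p) / real p) \<ge> 1" "(\<Sum>p\<in>W. ln (real p) / real p) \<le> 21"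
    using split mertens1[OF x1] mertens1[of x] lx lnx x1 x by (smt (verit) exp_ge_add_one_self)+
  have "1 \<le> (\<Sum>p\<in>W. ln x / (x / exp 11))"
    by (rule order.trans[OF b(1)], intro sum_mono frac_le) (use x0 lx in \<open>auto simp: W_def dest: prime_gt_0_nat\<close>)
  hence "1 \<le> real (card W) * (ln x * exp 11 / x)" by simp
  moreover have "exp 11 * ln x > 0" using lx by simp
  ultimately show "x / (exp 11 * ln x) \<le> real (card W)" using x0
    by (subst pos_divide_le_eq) (auto simp: field_simps)
  assume x': "x > exp 11"
  hence l: "ln (x / exp 11) > 0" by (intro ln_gt_zero) (simp add: less_divide_eq)
  have "(\<Sum>p\<in>W. ln (x / exp 11) / x) \<le> 21"
    by (rule order.trans[OF _ b(2)], intro sum_mono frac_le) (use x0 x1 l in \<open>auto simp: W_def dest: prime_gt_0_nat\<close>)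
  hence "real (card W) * (ln (x / exp 11) / x) \<le> 21" by simp
  thus "real (card W) \<le> 21 * x / ln (x / exp 11)" using x0 l by (simp add: field_simps)
qed

text \<open>A window of ratio \<open>exp b\<close> carries at most \<open>b + 10\<close> of the mass
  \<open>ln p / p\<close>, wherever it lies, and dividing by \<open>ln p \<ge> t\<close> saves the
  factor \<open>t\<close>. The start \<open>u\<close> will be a quotient of two products and may lie
  below 1, which is the second case.\<close>

lemma prime_window_reciprocals:
  assumes u: "u > 0" and b: "b \<ge> 1" and t: "t > 0"
    and W: "\<And>p. p \<in> W \<Longrightarrow> prime p \<and> u < real p \<and> real p \<le> exp b * u \<and> t \<le> ln (real p)"
  shows "(\<Sum>p\<in>W. 1 / real p) \<le> (b + 10) / t"
proof -
  have finW: "finite W" by (rule finite_subset[OF _ finite_primes_le[of "exp b * u"]]) (use W in auto)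
  have s: "(\<Sum>p\<in>W. ln (real p) / real p) \<le> b + 10"
  proof (cases "u \<ge> 1")
    case True
    have "u \<le> exp b * u" using u b by simp
    have "exp b * u \<ge> 1 * 1" using True b by (intro mult_mono) auto
    have "(\<Sum>p\<in>W. ln (real p) / real p) + (\<Sum>p | prime p \<and> real p \<le> u. ln (real p) / real p)
      = (\<Sum>p\<in>W \<union> {p. prime p \<and> real p \<le> u}. ln (real p) / real p)"
      by (rule sum.union_disjoint[symmetric]) (use finW finite_primes_le W in force)+
    also have "\<dots> \<le> (\<Sum>p | prime p \<and> real p \<le> exp b * u. ln (real p) / real p)"
      using W \<open>u \<le> exp b * u\<close> by (intro sum_mono2 finite_primes_le) (auto dest: prime_ge_1_nat)
    also have "\<dots> \<le> ln (exp b * u) + 6" using \<open>exp b * u \<ge> 1 * 1\<close> by (intro mertens1) simp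
    also have "ln (exp b * u) = b + ln u" using u by (simp add: ln_mult)
    finally show ?thesis using mertens1(2)[OF True] by linarith
  next
    case False
    have "exp b * u \<le> exp b" using False by simp
    have "(\<Sum>p\<in>W. ln (real p) / real p) \<le> (\<Sum>p | prime p \<and> real p \<le> exp b. ln (real p) / real p)"
    proof (intro sum_mono2 finite_primes_le)
      show "W \<subseteq> {p. prime p \<and> real p \<le> exp b}"
        using W \<open>exp b * u \<le> exp b\<close> by (blast intro: order.trans)
    qed (auto dest: prime_ge_1_nat)
    also have "\<dots> \<le> ln (exp b) + 6" using b by (intro mertens1) simp
    finally show ?thesis by simp
  qed
  have "t * (\<Sum>p\<in>W. 1 / real p) \<le> (\<Sum>p\<in>W. ln (real p) / real p)"
    unfolding sum_distrib_left using W by (intro sum_mono) (auto intro!: divide_right_mono)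
  hence "t * (\<Sum>p\<in>W. 1 / real p) \<le> b + 10" using s by linarith
  thus ?thesis using t by (simp add: field_simps)
qed

text \<open>A difference of two values of \<open>ln ln\<close>, so that the mass does not depend on
  the start \<open>a\<close>; 84 is twice the error in \<open>mertens2\<close>.\<close>

lemma prime_scale_reciprocals:
  assumes a: "a \<ge> 1" and T: "T \<ge> 1"
  shows "\<bar>(\<Sum>p | prime p \<and> exp a < real p \<and> real p \<le> exp (a * T). 1 / real p) - ln T\<bar> \<le> 84"
proof -
  have ge2: "exp b \<ge> 2" if "b \<ge> 1" for b :: real using exp_ge_add_one_self[of b] that by linarith
  have aT: "a * T \<ge> a" using a T by simp
  have "{p. prime p \<and> real p \<le> exp (a * T)} = {p. prime p \<and> real p \<le> exp a} \<union> {p. prime p \<and> exp a < real p \<and> real p \<le> exp (a * T)}"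
    using order.trans[OF _ iffD2[OF exp_le_cancel_iff aT]] by auto
  moreover have "finite {p. prime p \<and> exp a < real p \<and> real p \<le> exp (a * T)}"
    by (rule finite_subset[OF _ finite_primes_le[of "exp (a * T)"]]) auto
  ultimately have "(\<Sum>p | prime p \<and> real p \<le> exp (a * T). 1 / real p) =
     (\<Sum>p | prime p \<and> real p \<le> exp a. 1 / real p) + (\<Sum>p | prime p \<and> exp a < real p \<and> real p \<le> exp (a * T). 1 / real p)"
    by (simp only:) (rule sum.union_disjoint, auto simp: finite_primes_le)
  moreover have "\<bar>(\<Sum>p | prime p \<and> real p \<le> exp (a * T). 1 / real p) - (ln a + ln T)\<bar> \<le> 42"
    using mertens2[OF ge2, of "a * T"] a T aT by (simp add: ln_mult)
  moreover have "\<bar>(\<Sum>p | prime p \<and> real p \<le> exp a. 1 / real p) - ln a\<bar> \<le> 42"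
    using mertens2[OF ge2[OF a]] by simp
  ultimately show ?thesis by linarith
qed

section \<open>Sums over sets of primes\<close>

lemma sum_Pow_prod:
  fixes f :: "'a \<Rightarrow> bool \<Rightarrow> real"
  assumes "finite P"
  shows "(\<Sum>A\<in>Pow P. \<Prod>p\<in>P. f p (p \<in> A)) = (\<Prod>p\<in>P. f p True + f p False)"
proof -
  have "(\<Prod>p\<in>P. f p True + f p False) = (\<Sum>A\<in>Pow P. (\<Prod>p\<in>A. f p True) * (\<Prod>p\<in>P-A. f p False))"
    by (rule prod_add) fact
  also have "\<dots> = (\<Sum>A\<in>Pow P. \<Prod>p\<in>P. f p (p \<in> A))"
  proof (intro sum.cong refl)
    fix A assume "A \<in> Pow P"
    hence "(\<Prod>p\<in>P. f p (p \<in> A)) = (\<Prod>p\<in>P-A. f p (p \<in> A)) * (\<Prod>p\<in>A. f p (p \<in> A))"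
      using assms by (intro prod.subset_diff) auto
    thus "(\<Prod>p\<in>A. f p True) * (\<Prod>p\<in>P-A. f p False) = (\<Prod>p\<in>P. f p (p \<in> A))" by simp
  qed
  finally show ?thesis ..
qed

lemma sum_Pow_Pow_prod:
  fixes g :: "'a \<Rightarrow> bool \<Rightarrow> bool \<Rightarrow> real"
  assumes "finite P"
  shows "(\<Sum>A\<in>Pow P. \<Sum>B\<in>Pow P. \<Prod>p\<in>P. g p (p \<in> A) (p \<in> B))
     = (\<Prod>p\<in>P. (g p True True + g p True False) + (g p False True + g p False False))"
  by (simp only: sum_Pow_prod[OF assms, of "\<lambda>p b. g p (p \<in> _) b"]
      sum_Pow_prod[OF assms, of "\<lambda>p a. g p a True + g p a False"])

text \<open>Extending a set \<open>B\<close> of size \<open>i\<close> by a prime outside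
  \<open>B\<close> produces each set of size \<open>i + 1\<close> exactly \<open>i + 1\<close>
  times. Fewer than \<open>h\<close> primes, each at least \<open>h\<close>, are excluded, so that
  the available reciprocals still add up to the full sum minus 1.\<close>

lemma elementary_symmetric_lower:
  fixes I :: "nat set"
  assumes fin: "finite I" and pos: "\<And>p. p \<in> I \<Longrightarrow> real p \<ge> real h \<and> p > 0"
    and S: "(\<Sum>p\<in>I. 1 / real p) \<ge> 1"
  shows "((\<Sum>p\<in>I. 1 / real p) - 1) ^ h / fact h \<le> (\<Sum>B | B \<subseteq> I \<and> card B = h. 1 / real (\<Prod>B))"
proof -
  define S where "S = (\<Sum>p\<in>I. 1 / real p)"
  define F where "F = (\<lambda>B::nat set. 1 / real (\<Prod>B))"
  define X where "X = (\<lambda>i. {B. B \<subseteq> I \<and> card B = i})"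
  have finX: "finite (X i)" for i unfolding X_def using fin by simp
  have finB: "finite B" if "B \<in> X i" for B i using that fin finite_subset by (auto simp: X_def)
  have F0: "F B \<ge> 0" for B unfolding F_def by (simp add: prod_nonneg)
  have "(S - 1) ^ i / fact i \<le> (\<Sum>B\<in>X i. F B)" if "i \<le> h" for i
    using that
  proof (induction i)
    case 0
    have "X 0 = {{}}" using fin by (auto simp: X_def dest: finite_subset)
    thus ?case by (simp add: F_def)
  next
    case (Suc i)
    have "real (Suc i) * (\<Sum>B\<in>X (Suc i). F B) = (\<Sum>B\<in>X (Suc i). \<Sum>p\<in>B. F B)"
      by (simp add: sum_distrib_left X_def)
    also have "\<dots> = (\<Sum>(B, p)\<in>Sigma (X (Suc i)) (\<lambda>B. B). F B)"
      using finX finB by (subst sum.Sigma) auto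
    also have "\<dots> = (\<Sum>(B, p)\<in>Sigma (X i) (\<lambda>B. I - B). F B * (1 / real p))"
    proof (rule sum.reindex_bij_witness[where i="\<lambda>(B, p). (insert p B, p)" and j="\<lambda>(B, p). (B - {p}, p)"], goal_cases)
      case (3 x)
      thus ?case using fin by (auto simp: X_def card_insert_if dest: finite_subset)
    next
      case (5 x)
      obtain B p where x: "x = (B, p)" by force
      have "real (\<Prod>B) = real p * real (\<Prod>(B - {p}))"
        using 5 x finB[of B] by (subst prod.remove[of _ p]) auto
      thus ?case using x by (simp add: F_def)
    next
      case (2 x)
      thus ?case using fin by (auto simp: X_def dest: finite_subset)
    next
      case (4 x)
      thus ?case using fin by (auto simp: X_def card_insert_if dest: finite_subset)
    qed (use fin in \<open>auto simp: X_def dest: finite_subset\<close>)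
    also have "\<dots> = (\<Sum>B\<in>X i. F B * (\<Sum>p\<in>I-B. 1 / real p))"
      using finX fin by (subst sum.Sigma[symmetric]) (auto simp: sum_distrib_left)
    also have "\<dots> \<ge> (\<Sum>B\<in>X i. F B * (S - 1))"
    proof (intro sum_mono mult_left_mono F0)
      fix B assume B: "B \<in> X i"
      have "(\<Sum>p\<in>B. 1 / real p) \<le> (\<Sum>p\<in>B. 1 / real h)"
        using B pos Suc.prems by (intro sum_mono frac_le) (auto simp: X_def)
      also have "\<dots> = real i / real h" using B by (simp add: X_def)
      also have "\<dots> \<le> 1" using Suc.prems by simp
      finally have "(\<Sum>p\<in>B. 1 / real p) \<le> 1" .
      moreover have "S = (\<Sum>p\<in>I-B. 1 / real p) + (\<Sum>p\<in>B. 1 / real p)"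
        unfolding S_def using B fin by (intro sum.subset_diff) (auto simp: X_def)
      ultimately show "S - 1 \<le> (\<Sum>p\<in>I-B. 1 / real p)" by linarith
    qed
    finally have "(S - 1) * (\<Sum>B\<in>X i. F B) \<le> real (Suc i) * (\<Sum>B\<in>X (Suc i). F B)"
      by (simp add: sum_distrib_right[symmetric] mult.commute)
    moreover have "(S - 1) * ((S - 1) ^ i / fact i) \<le> (S - 1) * (\<Sum>B\<in>X i. F B)"
      using Suc assms(3) by (intro mult_left_mono) (auto simp: S_def)
    ultimately have "(S - 1) * ((S - 1) ^ i / fact i) \<le> real (Suc i) * (\<Sum>B\<in>X (Suc i). F B)" by linarith
    hence "(S - 1) * ((S - 1) ^ i / fact i) / real (Suc i) \<le> (\<Sum>B\<in>X (Suc i). F B)"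
      by (subst pos_divide_le_eq) (auto simp: mult.commute)
    moreover have "(S - 1) * ((S - 1) ^ i / fact i) / real (Suc i) = (S - 1) ^ Suc i / fact (Suc i)"
      by (simp add: mult.commute)
    ultimately show ?case by (simp only:)
  qed
  from this[of h] show ?thesis unfolding S_def F_def X_def by simp
qed

section \<open>From finite families of integers to \<open>T1\<close>\<close>

text \<open>The weight of \<open>m\<close> is the number of its preimages under
  \<open>\<phi>\<close>, so the family may take a value repeatedly. Values within a factor
  \<open>c\<close> of \<open>N\<close> let \<open>sqrt (m1 * m2)\<close> be replaced by
  \<open>N / c\<close>.\<close>

lemma T1_le_family:
  fixes \<phi> :: "'a \<Rightarrow> nat"
  assumes X: "finite X" "X \<noteq> {}" and c: "c > 0" and N: "N > 0"
    and phi: "\<And>x. x \<in> X \<Longrightarrow> \<phi> x \<in> {1..N} \<and> real N / c \<le> real (\<phi> x)"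
  shows "T1 N \<le> c / (real (card X))\<^sup>2 * (\<Sum>x\<in>X. \<Sum>y\<in>X. real (gcd (\<phi> x) (\<phi> y)))"
proof -
  define w where "w = (\<lambda>m. \<Sum>x\<in>X. of_bool (\<phi> x = m) :: real)"
  have w0: "w m \<ge> 0" for m unfolding w_def by (intro sum_nonneg) auto
  have push: "(\<Sum>m=1..N. w m * F m) = (\<Sum>x\<in>X. F (\<phi> x))" for F :: "nat \<Rightarrow> real"
  proof -
    have "(\<Sum>m=1..N. w m * F m) = (\<Sum>m=1..N. \<Sum>x\<in>X. of_bool (\<phi> x = m) * F m)"
      unfolding w_def by (simp only: sum_distrib_right)
    also have "\<dots> = (\<Sum>x\<in>X. \<Sum>m=1..N. of_bool (\<phi> x = m) * F m)" by (rule sum.swap)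
    also have "\<dots> = (\<Sum>x\<in>X. F (\<phi> x))"
    proof (intro sum.cong refl)
      fix x assume x: "x \<in> X"
      have "(\<Sum>m=1..N. of_bool (\<phi> x = m) * F m) = (\<Sum>m\<in>{\<phi> x}. of_bool (\<phi> x = m) * F m)"
        using phi[OF x] by (intro sum.mono_neutral_right) auto
      thus "(\<Sum>m=1..N. of_bool (\<phi> x = m) * F m) = F (\<phi> x)" by simp
    qed
    finally show ?thesis .
  qed
  have norm: "norm1 N w = real (card X)" unfolding norm1_def using push[of "\<lambda>_. 1"] by simp
  have cX: "real (card X) > 0" using X by (simp add: card_gt_0_iff)
  have wN: "w \<in> weights N"
  proof -
    have "\<exists>m\<in>{1..N}. w m \<noteq> 0"
    proof (rule ccontr)
      assume "\<not> (\<exists>m\<in>{1..N}. w m \<noteq> 0)"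
      hence "norm1 N w = 0" unfolding norm1_def by (intro sum.neutral) auto
      thus False using norm cX by simp
    qed
    thus ?thesis using w0 by (simp add: weights_def)
  qed
  have "T1 N \<le> real N / (norm1 N w)\<^sup>2 *
     (\<Sum>m1=1..N. \<Sum>m2=1..N. w m1 * w m2 * (real (gcd m1 m2) / sqrt (real m1 * real m2)))"
    unfolding T1_def
  proof (rule cINF_lower[OF _ wN])
    show "bdd_below ((\<lambda>w. real N / (norm1 N w)\<^sup>2 *
     (\<Sum>m1=1..N. \<Sum>m2=1..N. w m1 * w m2 * (real (gcd m1 m2) / sqrt (real m1 * real m2)))) ` weights N)"
      by (rule bdd_belowI2[of _ 0]) (auto simp: weights_def intro!: mult_nonneg_nonneg divide_nonneg_nonneg sum_nonneg)
  qed
  hence le: "T1 N \<le> real N / (real (card X))\<^sup>2 *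
     (\<Sum>m1=1..N. \<Sum>m2=1..N. w m1 * w m2 * (real (gcd m1 m2) / sqrt (real m1 * real m2)))"
    by (simp only: norm)
  have "(\<Sum>m1=1..N. \<Sum>m2=1..N. w m1 * w m2 * (real (gcd m1 m2) / sqrt (real m1 * real m2)))
     = (\<Sum>m1=1..N. w m1 * (\<Sum>m2=1..N. w m2 * (real (gcd m1 m2) / sqrt (real m1 * real m2))))"
    by (simp only: sum_distrib_left mult.assoc)
  also have "\<dots> = (\<Sum>x\<in>X. \<Sum>y\<in>X. real (gcd (\<phi> x) (\<phi> y)) / sqrt (real (\<phi> x) * real (\<phi> y)))"
    by (simp only: push)
  also have "\<dots> \<le> (\<Sum>x\<in>X. \<Sum>y\<in>X. real (gcd (\<phi> x) (\<phi> y)) * (c / real N))"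
  proof (intro sum_mono)
    fix x y assume xy: "x \<in> X" "y \<in> X"
    have "(real N / c) * (real N / c) \<le> real (\<phi> x) * real (\<phi> y)"
      using phi[OF xy(1)] phi[OF xy(2)] c by (intro mult_mono) auto
    hence "real N / c \<le> sqrt (real (\<phi> x) * real (\<phi> y))"
      by (intro real_le_rsqrt) (simp only: power2_eq_square)
    hence "real (gcd (\<phi> x) (\<phi> y)) / sqrt (real (\<phi> x) * real (\<phi> y)) \<le> real (gcd (\<phi> x) (\<phi> y)) / (real N / c)"
      using N c by (intro frac_le) auto
    thus "real (gcd (\<phi> x) (\<phi> y)) / sqrt (real (\<phi> x) * real (\<phi> y)) \<le> real (gcd (\<phi> x) (\<phi> y)) * (c / real N)"
      by simp
  qed
  also have "\<dots> = (c / real N) * (\<Sum>x\<in>X. \<Sum>y\<in>X. real (gcd (\<phi> x) (\<phi> y)))"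
    by (simp only: sum_distrib_left mult.commute)
  finally have "real N / (real (card X))\<^sup>2 *
     (\<Sum>m1=1..N. \<Sum>m2=1..N. w m1 * w m2 * (real (gcd m1 m2) / sqrt (real m1 * real m2)))
     \<le> real N / (real (card X))\<^sup>2 * ((c / real N) * (\<Sum>x\<in>X. \<Sum>y\<in>X. real (gcd (\<phi> x) (\<phi> y))))"
    by (intro mult_left_mono) auto
  with le show ?thesis using N by simp
qed

lemma T0_le_T1:
  assumes "N \<ge> 1"
  shows "T0 N \<le> T1 N"
  unfolding T0_def T1_def
proof (rule cINF_mono)
  have "(\<lambda>_. 1) \<in> weights N" using assms unfolding weights_def by auto
  thus "weights N \<noteq> {}" by blast
  show "bdd_below ((\<lambda>w. real N / (norm1 N w)\<^sup>2 *
     (\<Sum>m1=1..N. \<Sum>m2=1..N. w m1 * w m2 * (real (gcd m1 m2) / (real m1 + real m2)))) ` weights N)"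
    by (rule bdd_belowI2[of _ 0]) (auto simp: weights_def intro!: mult_nonneg_nonneg divide_nonneg_nonneg sum_nonneg)
  fix w assume w: "w \<in> weights N"
  show "\<exists>v\<in>weights N. real N / (norm1 N v)\<^sup>2 *
     (\<Sum>m1=1..N. \<Sum>m2=1..N. v m1 * v m2 * (real (gcd m1 m2) / (real m1 + real m2))) \<le> real N / (norm1 N w)\<^sup>2 *
     (\<Sum>m1=1..N. \<Sum>m2=1..N. w m1 * w m2 * (real (gcd m1 m2) / sqrt (real m1 * real m2)))"
  proof (intro bexI[OF _ w] mult_left_mono sum_mono)
    fix m1 m2 assume m: "m1 \<in> {1..N}" "m2 \<in> {1..N}"
    show "real (gcd m1 m2) / (real m1 + real m2) \<le> real (gcd m1 m2) / sqrt (real m1 * real m2)"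
      using m arith_geo_mean_sqrt[of "real m1" "real m2"] by (intro divide_left_mono) (auto intro: add_pos_pos)
    show "0 \<le> w m1 * w m2" using w m by (auto simp: weights_def)
  qed auto
qed

section \<open>The construction for the upper bound\<close>

text \<open>
  The prime scale \<open>I j\<close> collects the primes whose logarithm lies in \<open>(T ^ j, T ^ (j + 1)]\<close>. The primes with
  logarithm up to \<open>T\<close> or above \<open>T ^ (K + 1)\<close> are left out, so that a product of \<open>K h\<close> scale primes is at
  most \<open>sqrt N\<close> and leaves room for a large prime factor. A number of the construction
  is \<open>p * \<Prod>A\<close> with \<open>A \<in> R\<close> and \<open>p \<in> V A\<close>. As all prime sets are squarefree, \<open>G A B\<close> is
  \<open>gcd / product\<close> of the two numbers \<open>\<Prod>A\<close> and \<open>\<Prod>B\<close>.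
\<close>

locale gal_construction =
  fixes N K h :: nat and T :: real
  assumes T_ge: "45 \<le> T" and ln_N: "ln (real N) = T ^ (K + 2)" and hK: "2 * real K * real h \<le> T"
begin

definition I :: "nat \<Rightarrow> nat set" where
  "I j = {p. prime p \<and> exp (T ^ j) < real p \<and> real p \<le> exp (T ^ j * T)}"

definition Low :: "nat \<Rightarrow> nat set" where "Low j = (\<Union>i\<in>{1..j}. I i)"
definition High :: "nat \<Rightarrow> nat set" where "High j = (\<Union>i\<in>{j+1..K}. I i)"
definition P :: "nat set" where "P = (\<Union>i\<in>{1..K}. I i)"

text \<open>Every scale carries reciprocal mass about \<open>ln T\<close>; accordingly
  \<open>h\<close> will be \<open>k * ln T\<close> rounded down.\<close>

definition R :: "nat set set" where
  "R = {A. A \<subseteq> P \<and> (\<forall>j\<in>{1..K}. card (A \<inter> I j) = h)}"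

text \<open>The large prime brings the product to within a factor \<open>exp 11\<close> of
  \<open>N\<close>, as \<open>T1_le_family\<close> demands.\<close>

definition V :: "nat set \<Rightarrow> nat set" where
  "V A = {p. prime p \<and> real N / real (\<Prod>A) / exp 11 < real p \<and> real p \<le> real N / real (\<Prod>A)}"

definition G :: "nat set \<Rightarrow> nat set \<Rightarrow> real" where
  "G A B = 1 / real (\<Prod>(A \<union> B))"

text \<open>The exact counts are relaxed to upper bounds: the set then survives the deletion of a
  low prime, and Rankin's trick sees nothing more anyway. At the ends, \<open>F 0\<close> contains
  the diagonal of \<open>R\<close> and \<open>F K\<close> all of
  \<open>R \<times> R\<close>.\<close>

definition F :: "nat \<Rightarrow> (nat set \<times> nat set) set" where
  "F j = {(A, B). A \<subseteq> P \<and> B \<subseteq> P \<and> card (A \<inter> Low j) + card (B \<inter> Low j) \<le> 2 * j * h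
      \<and> A \<inter> High j = B \<inter> High j \<and> card (A \<inter> High j) \<le> (K - j) * h}"

text \<open>Up to constants the family has \<open>N * M / T ^ (K + 2)\<close> members.\<close>

definition M :: real where "M = (\<Sum>A\<in>R. 1 / real (\<Prod>A))"

text \<open>A necessary condition for \<open>V A\<close> and \<open>V B\<close> to share a
  prime.\<close>

definition near :: "nat set \<Rightarrow> nat set \<Rightarrow> bool" where
  "near A B \<longleftrightarrow> real (\<Prod>B) < exp 11 * real (\<Prod>A) \<and> real (\<Prod>A) < exp 11 * real (\<Prod>B)"

section \<open>Scales, large primes and their gcds\<close>

lemma T_ge_1: "T \<ge> 1" "T > 0" using T_ge by auto

lemma finite_I: "finite (I j)"
  unfolding I_def by (rule finite_subset[OF _ finite_primes_le[of "exp (T ^ j * T)"]]) auto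

lemma finite_P: "finite P" unfolding P_def using finite_I by auto

lemma finite_sub_P: "A \<subseteq> P \<Longrightarrow> finite A" using finite_P finite_subset by blast

lemma prime_P: "p \<in> P \<Longrightarrow> prime p" unfolding P_def I_def by auto

lemma I_disjoint: "i \<noteq> j \<Longrightarrow> I i \<inter> I j = {}"
proof (induction i j rule: linorder_wlog)
  case (le i j)
  hence "T ^ Suc i \<le> T ^ j" using T_ge_1 by (intro power_increasing) auto
  hence "exp (T ^ i * T) \<le> exp (T ^ j)" by (simp add: mult.commute)
  hence "real x \<le> exp (T ^ j)" if "x \<in> I i" for x using that unfolding I_def mem_Collect_eq by (meson order.trans)
  moreover have "exp (T ^ j) < real x" if "x \<in> I j" for x
    using that unfolding I_def mem_Collect_eq by blast
  ultimately show ?case by (meson disjoint_iff not_le)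
qed (simp add: Int_commute)

lemma card_Int_UN:
  assumes "finite S"
  shows "card (A \<inter> (\<Union>i\<in>S. I i)) = (\<Sum>i\<in>S. card (A \<inter> I i))"
proof -
  have "A \<inter> (\<Union>i\<in>S. I i) = (\<Union>i\<in>S. A \<inter> I i)" by auto
  thus ?thesis using assms finite_I I_disjoint by (simp only:) (rule card_UN_disjoint, auto)
qed

lemma card_Low: "A \<in> R \<Longrightarrow> j \<le> K \<Longrightarrow> card (A \<inter> Low j) = j * h"
  unfolding Low_def by (subst card_Int_UN) (auto simp: R_def)

lemma card_High: "A \<in> R \<Longrightarrow> card (A \<inter> High j) = (K - j) * h"
  unfolding High_def by (subst card_Int_UN) (auto simp: R_def)

lemma P_split: "j \<le> K \<Longrightarrow> P = Low j \<union> High j"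
  unfolding P_def Low_def High_def by force

lemma Low_High_disjoint: "Low j \<inter> High j = {}"
proof -
  have "I i \<inter> I i' = {}" if "i \<in> {1..j}" "i' \<in> {j+1..K}" for i i'
    using that by (intro I_disjoint) auto
  thus ?thesis unfolding Low_def High_def by blast
qed

lemma R_sub: "A \<in> R \<Longrightarrow> A \<subseteq> P" by (auto simp: R_def)

lemma finite_R: "finite R" by (rule finite_subset[of _ "Pow P"]) (auto simp: R_def finite_P)

lemma prod_pos_P: "A \<subseteq> P \<Longrightarrow> real (\<Prod>A) > 0"
  using prime_P by (simp, intro prod_pos) (auto dest!: prime_gt_0_nat)

lemma G_nonneg: "A \<subseteq> P \<Longrightarrow> B \<subseteq> P \<Longrightarrow> G A B \<ge> 0"
  unfolding G_def using prod_pos_P[of "A \<union> B"] by simp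

lemma N_pos: "N > 0"
  using ln_N T_ge_1 zero_less_power[of T "K+2"] by (intro Nat.gr0I) simp

lemma P_le: "p \<in> P \<Longrightarrow> ln (real p) \<le> T ^ (K + 1)"
proof -
  assume "p \<in> P"
  then obtain j where j: "j \<le> K" "prime p" "real p \<le> exp (T ^ j * T)" by (auto simp: P_def I_def)
  have "ln (real p) \<le> ln (exp (T ^ j * T))" using j prime_gt_0_nat by (intro ln_mono) auto
  also have "\<dots> = T ^ (j + 1)" by simp
  also have "\<dots> \<le> T ^ (K + 1)" using T_ge_1 j by (intro power_increasing) auto
  finally show ?thesis .
qed

lemma ln_prod_le:
  assumes "A \<in> R"
  shows "ln (real (\<Prod>A)) \<le> T ^ (K + 2) / 2"
proof -
  have A: "A \<subseteq> P" "finite A" using assms R_sub finite_sub_P by auto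
  have "card A = K * h" using card_Low[OF assms, of K] A by (simp add: Low_def P_def Int_absorb2)
  have "ln (real (\<Prod>A)) = (\<Sum>p\<in>A. ln (real p))"
    unfolding of_nat_prod using A prime_P by (subst ln_prod) (auto dest!: prime_gt_0_nat)
  also have "\<dots> \<le> (\<Sum>p\<in>A. T ^ (K + 1))" using A P_le by (intro sum_mono) auto
  also have "\<dots> = (real K * real h) * T ^ (K + 1)" using \<open>card A = K * h\<close> by simp
  also have "\<dots> \<le> (T / 2) * T ^ (K + 1)" using hK T_ge_1 by (intro mult_right_mono) auto
  finally show ?thesis by simp
qed

lemma T_pow_ge: "T \<le> T ^ (K + 2)" using T_ge_1 power_increasing[of 1 "K+2" T] by simp

text \<open>The product takes up at most half of \<open>ln N\<close>, so the cofactor keeps the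
  other half. The bound 45 on \<open>T\<close> ensures that the window width 11 costs at most a
  further quarter.\<close>

lemma cofactor:
  assumes "A \<in> R"
  defines "x \<equiv> real N / real (\<Prod>A)"
  shows "x > exp 11" "ln x \<le> T ^ (K + 2)" "ln (x / exp 11) \<ge> T ^ (K + 2) / 4"
proof -
  have pos: "real (\<Prod>A) > 0" using prod_pos_P[OF R_sub[OF assms(1)]] .
  have "\<Prod>A \<ge> 1" using pos by linarith
  hence ge1: "real (\<Prod>A) \<ge> 1" by linarith
  have x0: "x > 0" using pos N_pos unfolding x_def by simp
  have lnx: "ln x = T ^ (K + 2) - ln (real (\<Prod>A))" unfolding x_def using pos N_pos ln_N by (simp add: ln_div)
  thus "ln x \<le> T ^ (K + 2)" using ge1 by simp
  have "ln x \<ge> T ^ (K + 2) / 2" using lnx ln_prod_le[OF assms(1)] by linarith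
  moreover have "T ^ (K + 2) / 4 \<ge> 11" using T_pow_ge T_ge by linarith
  moreover have "ln (x / exp 11) = ln x - 11" using x0 by (simp add: ln_div)
  ultimately show "ln (x / exp 11) \<ge> T ^ (K + 2) / 4" by linarith
  have "11 < ln x" using \<open>ln x \<ge> T ^ (K + 2) / 2\<close> \<open>T ^ (K + 2) / 4 \<ge> 11\<close> by linarith
  hence "exp 11 < exp (ln x)" by (simp only: exp_less_cancel_iff)
  thus "x > exp 11" using x0 by simp
qed

text \<open>The logarithm of a large prime is at least \<open>T ^ (K + 2) / 4\<close>, which exceeds
  the top of the scales because \<open>T > 4\<close>.\<close>

lemma V_not_P:
  assumes "A \<in> R" "p \<in> V A"
  shows "p \<notin> P"
proof
  assume "p \<in> P"
  have "T ^ (K + 1) * 4 < T ^ (K + 1) * T" using T_ge by (intro mult_strict_left_mono) auto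
  hence "T ^ (K + 1) < T ^ (K + 2) / 4" by (simp add: mult_ac)
  also have "\<dots> \<le> ln (real N / real (\<Prod>A) / exp 11)" by (rule cofactor) fact
  also have "\<dots> \<le> ln (real p)"
    using assms prod_pos_P[OF R_sub[OF assms(1)]] N_pos by (intro ln_mono) (auto simp: V_def)
  finally show False using P_le[OF \<open>p \<in> P\<close>] by simp
qed

lemma finite_V: "finite (V A)"
  unfolding V_def by (rule finite_subset[OF _ finite_primes_le[of "real N / real (\<Prod>A)"]]) auto

lemma card_V:
  assumes "A \<in> R"
  shows "real N / (exp 11 * T ^ (K + 2)) * (1 / real (\<Prod>A)) \<le> real (card (V A))"
    and "real (card (V A)) \<le> 84 * real N / T ^ (K + 2) * (1 / real (\<Prod>A))"
proof -
  define x where "x = real N / real (\<Prod>A)"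
  note c = cofactor[OF assms, folded x_def]
  have V: "V A = {p. prime p \<and> x / exp 11 < real p \<and> real p \<le> x}" by (simp add: V_def x_def)
  have Tp: "T ^ (K + 2) > 0" using T_ge_1 by simp
  have x0: "x > 0" using c(1) by (rule less_trans[rotated]) simp
  have lx: "ln x > 0" using c(1) by (intro ln_gt_zero) (rule less_trans[rotated], auto)
  have "x / (exp 11 * T ^ (K + 2)) \<le> x / (exp 11 * ln x)"
    using c lx x0 Tp by (intro divide_left_mono) auto
  also have "\<dots> \<le> real (card (V A))" unfolding V using c(1) by (intro prime_window_bounds) auto
  finally show "real N / (exp 11 * T ^ (K + 2)) * (1 / real (\<Prod>A)) \<le> real (card (V A))"
    by (simp add: x_def mult_ac)
  have "real (card (V A)) \<le> 21 * x / ln (x / exp 11)" unfolding V using c(1) by (intro prime_window_bounds) auto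
  also have "\<dots> \<le> 21 * x / (T ^ (K + 2) / 4)" using c x0 Tp by (intro divide_left_mono) auto
  finally show "real (card (V A)) \<le> 84 * real N / T ^ (K + 2) * (1 / real (\<Prod>A))"
    by (simp add: x_def mult_ac)
qed

text \<open>Large primes lie outside \<open>P\<close>, hence \<open>gcd p q\<close> splits off from
  the common part. The form \<open>1 + p\<close> separates a term present for all pairs from the
  term of coinciding large primes.\<close>

lemma gcd_prod:
  assumes A: "A \<in> R" "p \<in> V A" and B: "B \<in> R" "q \<in> V B"
  shows "real (gcd (p * \<Prod>A) (q * \<Prod>B)) \<le> real (\<Prod>(A \<inter> B)) * (1 + (if p = q then real p else 0))"
proof -
  have pr: "prime p" "prime q" using assms by (auto simp: V_def)
  have fin: "finite A" "finite B" using assms R_sub finite_sub_P by auto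
  have nP: "p \<notin> P" "q \<notin> P" using V_not_P assms by auto
  have cop: "coprime a (\<Prod>C)" if "prime a" "a \<notin> P" "C \<subseteq> P" for a C
    using that prime_P by (intro prod_coprime_right) (metis primes_coprime subsetD)
  have sub: "A - B \<subseteq> P" "B - A \<subseteq> P" using assms R_sub by auto
  have cAB: "coprime (\<Prod>(A - B)) (\<Prod>(B - A))"
    using sub prime_P by (intro prod_coprime_left prod_coprime_right) (metis DiffE primes_coprime subsetD)
  have split: "\<Prod>A = \<Prod>(A \<inter> B) * \<Prod>(A - B)" "\<Prod>B = \<Prod>(A \<inter> B) * \<Prod>(B - A)"
    using fin prod.Int_Diff[of A "\<lambda>x. x" B] prod.Int_Diff[of B "\<lambda>x. x" A] by (auto simp: Int_commute)
  have "gcd (p * \<Prod>A) (q * \<Prod>B) = \<Prod>(A \<inter> B) * gcd (p * \<Prod>(A - B)) (q * \<Prod>(B - A))"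
    unfolding split using gcd_mult_distrib_nat[of "\<Prod>(A \<inter> B)" "p * \<Prod>(A - B)" "q * \<Prod>(B - A)"]
    by (simp add: mult_ac)
  also have "gcd (p * \<Prod>(A - B)) (q * \<Prod>(B - A)) = gcd p q"
  proof -
    have "coprime (\<Prod>(A - B)) (q * \<Prod>(B - A))"
      using cAB cop[OF pr(2) nP(2) sub(1)] by (simp add: coprime_commute)
    hence "gcd (p * \<Prod>(A - B)) (q * \<Prod>(B - A)) = gcd p (q * \<Prod>(B - A))"
      by (metis gcd.commute gcd_mult_right_right_cancel coprime_commute)
    also have "\<dots> = gcd p q" using cop[OF pr(1) nP(1) sub(2)]
      by (simp add: gcd_mult_right_right_cancel)
    finally show ?thesis .
  qed
  also have "\<Prod>(A \<inter> B) * gcd p q \<le> \<Prod>(A \<inter> B) * (1 + (if p = q then p else 0))"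
  proof (intro mult_left_mono)
    show "gcd p q \<le> 1 + (if p = q then p else 0)"
    proof (cases "p = q")
      case False
      hence "gcd p q = 1" using primes_coprime[OF pr] by (intro coprime_imp_gcd_eq_1)
      thus ?thesis by simp
    qed simp
  qed simp
  finally have "real (gcd (p * \<Prod>A) (q * \<Prod>B)) \<le> real (\<Prod>(A \<inter> B) * (1 + (if p = q then p else 0)))"
    by (simp only: of_nat_le_iff)
  also have "real (\<Prod>(A \<inter> B) * (1 + (if p = q then p else 0))) = real (\<Prod>(A \<inter> B)) * (1 + (if p = q then real p else 0))"
    by (cases "p = q") (simp_all only: of_nat_mult of_nat_add of_nat_1 of_nat_0 if_True if_False simp_thms)
  finally show ?thesis .
qed

lemma G_eq:
  assumes "A \<subseteq> P" "B \<subseteq> P"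
  shows "real (\<Prod>(A \<inter> B)) * (1 / real (\<Prod>A)) * (1 / real (\<Prod>B)) = G A B"
proof -
  have "\<Prod>(A \<union> B) * \<Prod>(A \<inter> B) = \<Prod>A * \<Prod>B"
    using assms finite_sub_P by (intro prod.union_inter) auto
  hence "real (\<Prod>(A \<union> B)) * real (\<Prod>(A \<inter> B)) = real (\<Prod>A) * real (\<Prod>B)"
    by (simp only: of_nat_mult[symmetric])
  moreover have "real (\<Prod>A) > 0" "real (\<Prod>B) > 0" "real (\<Prod>(A \<union> B)) > 0"
    using assms by (intro prod_pos_P; auto)+
  ultimately show ?thesis unfolding G_def by (simp add: field_simps del: of_nat_prod)
qed

text \<open>A common prime is at most \<open>N / \<Prod>A\<close>, and \<open>V A\<close> is small.
  The resulting square of \<open>1 / \<Prod>A\<close> is turned into a form symmetric in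
  \<open>A\<close> and \<open>B\<close> by means of \<open>near\<close>.\<close>

lemma V_common:
  assumes A: "A \<in> R" and B: "B \<in> R"
  shows "(\<Sum>p\<in>V A \<inter> V B. real p) \<le> (if near A B then 84 * exp 11 * (real N)\<^sup>2 / T ^ (K + 2) * (1 / real (\<Prod>A)) * (1 / real (\<Prod>B)) else 0)"
proof -
  have pos: "real (\<Prod>A) > 0" "real (\<Prod>B) > 0" using prod_pos_P[OF R_sub] A B by auto
  have N0: "real N > 0" using N_pos by simp
  show ?thesis
  proof (cases "V A \<inter> V B = {}")
    case True
    thus ?thesis using T_ge_1 pos by (auto intro!: mult_nonneg_nonneg divide_nonneg_nonneg)
  next
    case False
    then obtain p where p: "p \<in> V A" "p \<in> V B" by auto
    have "real N / real (\<Prod>A) / exp 11 < real N / real (\<Prod>B)" "real N / real (\<Prod>B) / exp 11 < real N / real (\<Prod>A)"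
      using p by (auto simp: V_def)
    hence nr: "near A B" unfolding near_def using pos N0 by (simp_all add: field_simps del: of_nat_prod)
    have "(\<Sum>p\<in>V A \<inter> V B. real p) \<le> (\<Sum>p\<in>V A. real p)"
      using finite_V by (intro sum_mono2) auto
    also have "\<dots> \<le> (\<Sum>p\<in>V A. real N / real (\<Prod>A))" by (intro sum_mono) (auto simp: V_def)
    also have "\<dots> = real (card (V A)) * (real N / real (\<Prod>A))" by simp
    also have "\<dots> \<le> (84 * real N / T ^ (K + 2) * (1 / real (\<Prod>A))) * (real N / real (\<Prod>A))"
      using card_V(2)[OF A] pos by (intro mult_right_mono) auto
    also have "\<dots> = (84 * (real N)\<^sup>2 / T ^ (K + 2) * (1 / real (\<Prod>A))) * (1 / real (\<Prod>A))"
      by (simp add: power2_eq_square)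
    also have "\<dots> \<le> (84 * (real N)\<^sup>2 / T ^ (K + 2) * (1 / real (\<Prod>A))) * (exp 11 * (1 / real (\<Prod>B)))"
    proof (intro mult_left_mono)
      show "1 / real (\<Prod>A) \<le> exp 11 * (1 / real (\<Prod>B))"
        using nr pos unfolding near_def by (simp add: field_simps del: of_nat_prod)
    qed (use T_ge_1 pos in auto)
    finally show ?thesis using nr by (simp add: mult_ac)
  qed
qed

section \<open>Pairs sharing the large prime\<close>

lemma prod_remove:
  assumes "A \<subseteq> P" "q \<in> A"
  shows "real (\<Prod>A) = real q * real (\<Prod>(A - {q}))"
  using assms finite_sub_P[OF assms(1)] by (simp add: prod.remove[of A q])

text \<open>
  Let \<open>j\<close> be the highest scale at which \<open>A\<close> and \<open>B\<close> differ. A prime \<open>q \<in> A - B\<close> of that scale is confined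
  by \<open>near A B\<close> to a window of bounded ratio once \<open>A - {q}\<close> and \<open>B\<close> are given, and the reciprocals
  of the primes in such a window add up to \<open>O(1/T\<^sup>j)\<close>.
\<close>

lemma sum_G_top_scale:
  assumes j: "j \<in> {1..K}"
  defines "D \<equiv> {(A, B). A \<in> R \<and> B \<in> R \<and> near A B \<and> A \<inter> High j = B \<inter> High j \<and> (A - B) \<inter> I j \<noteq> {}}"
  shows "(\<Sum>(A, B)\<in>D. G A B) \<le> 32 / T ^ j * (\<Sum>(A, B)\<in>F j. G A B)"
proof -
  \<comment> \<open>Here \<open>A\<close> stands for the set from which \<open>q\<close> has already
    been removed. Read as a condition on \<open>q\<close>, \<open>near\<close> is a window of ratio
    \<open>exp 22\<close>, which yields 32 = 22 + 10 below.\<close>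
  define W where "W = (\<lambda>A B. {q \<in> I j. real (\<Prod>B) / (exp 11 * real (\<Prod>A)) < real q
      \<and> real q \<le> exp 22 * (real (\<Prod>B) / (exp 11 * real (\<Prod>A)))})"
  have finD: "finite D"
    by (rule finite_subset[of _ "R \<times> R"]) (auto simp: D_def finite_R)
  have finF: "finite (F j)"
    by (rule finite_subset[of _ "Pow P \<times> Pow P"]) (auto simp: F_def finite_P)
  have finW: "finite (W A B)" for A B unfolding W_def using finite_I by auto
  have IP: "I j \<subseteq> P" using j by (auto simp: P_def)
  define Z where "Z = Sigma D (\<lambda>(A, B). (A - B) \<inter> I j)"
  define g where "g = (\<lambda>((A, B), q). ((A - {q}, B), q) :: (nat set \<times> nat set) \<times> nat)"
  have finZ: "finite Z" unfolding Z_def using finD finite_I by auto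
  have "(\<Sum>(A, B)\<in>D. G A B) \<le> (\<Sum>(A, B)\<in>D. \<Sum>q\<in>(A - B) \<inter> I j. G A B)"
  proof (intro sum_mono, clarify)
    fix A B assume AB: "(A, B) \<in> D"
    hence "card ((A - B) \<inter> I j) > 0" using finite_I by (auto simp: D_def card_gt_0_iff)
    hence "1 * G A B \<le> real (card ((A - B) \<inter> I j)) * G A B"
      using AB R_sub by (intro mult_right_mono G_nonneg) (auto simp: D_def)
    thus "G A B \<le> (\<Sum>q\<in>(A - B) \<inter> I j. G A B)" by simp
  qed
  also have "\<dots> = (\<Sum>((A, B), q)\<in>Z. G A B)"
    unfolding Z_def case_prod_unfold using finD finite_I by (subst sum.Sigma) (auto simp: case_prod_unfold)
  \<comment> \<open>As \<open>q\<close> lies in \<open>A\<close> but not in \<open>B\<close>,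
    removing it from \<open>A\<close> removes it from \<open>A \<union> B\<close>, and
    \<open>1 / q\<close> splits off.\<close>
  also have "\<dots> = (\<Sum>x\<in>Z. case g x of ((A, B), q) \<Rightarrow> G A B * (1 / real q))"
  proof (intro sum.cong refl, clarify)
    fix A B q assume z: "((A, B), q) \<in> Z"
    hence "A \<union> B \<subseteq> P" "q \<in> A \<union> B" "A \<union> B - {q} = (A - {q}) \<union> B" using R_sub by (auto simp: Z_def D_def)
    hence "real (\<Prod>(A \<union> B)) = real q * real (\<Prod>((A - {q}) \<union> B))" using prod_remove[of "A \<union> B" q] by simp
    thus "G A B = (case g ((A, B), q) of ((A, B), q) \<Rightarrow> G A B * (1 / real q))"
      unfolding g_def G_def by (simp add: mult.commute del: of_nat_prod)
  qed
  also have "\<dots> = (\<Sum>((A, B), q)\<in>g ` Z. G A B * (1 / real q))"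
  proof -
    have "inj_on g Z" unfolding g_def Z_def by (auto simp: inj_on_def)
    thus ?thesis by (simp add: sum.reindex case_prod_unfold)
  qed
  also have "\<dots> \<le> (\<Sum>((A, B), q)\<in>Sigma (F j) (\<lambda>(A, B). W A B). G A B * (1 / real q))"
  proof (rule sum_mono2)
    show "finite (Sigma (F j) (\<lambda>(A, B). W A B))" using finF finW by auto
    show "g ` Z \<subseteq> Sigma (F j) (\<lambda>(A, B). W A B)"
    proof
      fix x assume "x \<in> g ` Z"
      then obtain A B q where x: "x = ((A - {q}, B), q)" and D: "(A, B) \<in> D" and q: "q \<in> A" "q \<notin> B" "q \<in> I j"
        by (auto simp: g_def Z_def)
      have AB: "A \<in> R" "B \<in> R" "near A B" "A \<inter> High j = B \<inter> High j" using D by (auto simp: D_def)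
      have sub: "A \<subseteq> P" "B \<subseteq> P" using AB R_sub by auto
      have "q \<in> Low j" using q j by (auto simp: Low_def)
      hence "q \<notin> High j" using Low_High_disjoint by blast
      hence hi: "(A - {q}) \<inter> High j = A \<inter> High j" by auto
      have "card ((A - {q}) \<inter> Low j) \<le> card (A \<inter> Low j)"
        using finite_sub_P[OF sub(1)] by (intro card_mono) auto
      hence "(A - {q}, B) \<in> F j"
        using sub AB hi card_Low[of A j] card_Low[of B j] card_High[of A j] j unfolding F_def
        by (auto simp: mult.commute)
      moreover have "q \<in> W (A - {q}) B"
      proof -
        have pos: "real (\<Prod>B) > 0" "real (\<Prod>(A - {q})) > 0" 
          using prod_pos_P[of B] prod_pos_P[of "A - {q}"] sub by auto
        have "real (\<Prod>B) < exp 11 * (real q * real (\<Prod>(A - {q})))"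
             "real q * real (\<Prod>(A - {q})) < exp 11 * real (\<Prod>B)"
          using AB(3) prod_remove[OF sub(1) q(1)] unfolding near_def by auto
        moreover have "exp 22 = exp 11 * exp (11::real)" by (simp add: exp_add[symmetric])
        ultimately show ?thesis using q(3) pos unfolding W_def
          by (simp add: field_simps del: of_nat_prod)
      qed
      ultimately show "x \<in> Sigma (F j) (\<lambda>(A, B). W A B)" using x by auto
    qed
  qed (use G_nonneg in \<open>auto simp: F_def\<close>)
  also have "\<dots> = (\<Sum>(A, B)\<in>F j. \<Sum>q\<in>W A B. G A B * (1 / real q))"
    unfolding case_prod_unfold using finF finW by (subst sum.Sigma) (auto simp: case_prod_unfold)
  also have "\<dots> \<le> (\<Sum>(A, B)\<in>F j. G A B * (32 / T ^ j))"
  proof (intro sum_mono, clarify)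
    fix A B assume "(A, B) \<in> F j"
    hence sub: "A \<subseteq> P" "B \<subseteq> P" by (auto simp: F_def)
    have "(\<Sum>q\<in>W A B. 1 / real q) \<le> (22 + 10) / T ^ j"
    proof (rule prime_window_reciprocals)
      show "real (\<Prod>B) / (exp 11 * real (\<Prod>A)) > 0" using prod_pos_P sub by (simp del: of_nat_prod)
      show "T ^ j > 0" using T_ge_1 by simp
      fix q assume q: "q \<in> W A B"
      hence "exp (T ^ j) < real q" "prime q" by (auto simp: W_def I_def)
      hence "T ^ j \<le> ln (real q)" by (subst ln_ge_iff) (auto dest: prime_gt_0_nat)
      thus "prime q \<and> real (\<Prod>B) / (exp 11 * real (\<Prod>A)) < real q
         \<and> real q \<le> exp 22 * (real (\<Prod>B) / (exp 11 * real (\<Prod>A))) \<and> T ^ j \<le> ln (real q)"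
        using q by (auto simp: W_def I_def)
    qed simp
    hence "G A B * (\<Sum>q\<in>W A B. 1 / real q) \<le> G A B * (32 / T ^ j)"
      using G_nonneg[OF sub] by (intro mult_left_mono) auto
    thus "(\<Sum>q\<in>W A B. G A B * (1 / real q)) \<le> G A B * (32 / T ^ j)"
      by (simp only: sum_distrib_left)
  qed
  also have "\<dots> = 32 / T ^ j * (\<Sum>(A, B)\<in>F j. G A B)"
    by (simp only: sum_distrib_left case_prod_unfold mult.commute)
  finally show ?thesis .
qed

text \<open>Distinct \<open>A\<close> and \<open>B\<close> have a highest scale at which they
  differ. Since both have \<open>h\<close> primes there, \<open>A - B\<close> cannot be empty on it,
  so one of the sets \<open>D j\<close> of \<open>sum_G_top_scale\<close> contains the pair; index 0
  is given to the diagonal.\<close>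

lemma sum_G_near:
  "(\<Sum>(A, B) | A \<in> R \<and> B \<in> R \<and> near A B. G A B) \<le> 32 * (\<Sum>j=0..K. 1 / T ^ j * (\<Sum>(A, B)\<in>F j. G A B))"
proof -
  define E where "E = {(A, B). A \<in> R \<and> B \<in> R \<and> near A B}"
  define D where "D = (\<lambda>j. if j = 0 then {(A, B). A \<in> R \<and> B = A} else
     {(A, B). A \<in> R \<and> B \<in> R \<and> near A B \<and> A \<inter> High j = B \<inter> High j \<and> (A - B) \<inter> I j \<noteq> {}})"
  have finE: "finite E" by (rule finite_subset[of _ "R \<times> R"]) (auto simp: E_def finite_R)
  have finD: "finite (D j)" for j
    by (rule finite_subset[of _ "R \<times> R"]) (auto simp: D_def finite_R split: if_splits)
  have Gn: "G A B \<ge> 0" if "A \<in> R" "B \<in> R" for A B using that R_sub by (intro G_nonneg) auto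
  have cover: "\<exists>j\<in>{0..K}. (A, B) \<in> D j" if AB: "(A, B) \<in> E" for A B
  proof (cases "A = B")
    case True
    thus ?thesis using AB by (intro bexI[of _ 0]) (auto simp: D_def E_def)
  next
    case False
    define S where "S = {i\<in>{1..K}. A \<inter> I i \<noteq> B \<inter> I i}"
    have sub: "A \<subseteq> P" "B \<subseteq> P" using AB R_sub by (auto simp: E_def)
    have "S \<noteq> {}"
    proof
      assume "S = {}"
      hence "A \<inter> P = B \<inter> P" unfolding S_def P_def by blast
      thus False using sub False by blast
    qed
    moreover have "finite S" unfolding S_def by auto
    ultimately have jS: "Max S \<in> S" and mx: "\<And>i. i \<in> S \<Longrightarrow> i \<le> Max S" by auto
    define j where "j = Max S"
    have j: "j \<in> {1..K}" "A \<inter> I j \<noteq> B \<inter> I j" using jS by (auto simp: S_def j_def)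
    have "A \<inter> I i = B \<inter> I i" if "i \<in> {j+1..K}" for i
      using mx[of i] that unfolding S_def j_def by fastforce
    hence hi: "A \<inter> High j = B \<inter> High j" unfolding High_def by blast
    have "(A - B) \<inter> I j \<noteq> {}"
    proof
      assume "(A - B) \<inter> I j = {}"
      hence "A \<inter> I j \<subseteq> B \<inter> I j" by blast
      moreover have "card (A \<inter> I j) = card (B \<inter> I j)" using AB j by (auto simp: E_def R_def)
      ultimately have "A \<inter> I j = B \<inter> I j" using finite_I by (intro card_subset_eq) auto
      thus False using j by simp
    qed
    thus ?thesis using AB j hi by (intro bexI[of _ j]) (auto simp: D_def E_def)
  qed
  have "(\<Sum>(A, B)\<in>E. G A B) \<le> (\<Sum>(A, B)\<in>E. \<Sum>j=0..K. of_bool ((A, B) \<in> D j) * G A B)"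
  proof (intro sum_mono, clarify)
    fix A B assume AB: "(A, B) \<in> E"
    then obtain j where j: "j \<in> {0..K}" "(A, B) \<in> D j" using cover by blast
    have "of_bool ((A, B) \<in> D j) * G A B \<le> (\<Sum>j=0..K. of_bool ((A, B) \<in> D j) * G A B)"
      using j AB Gn by (intro member_le_sum) (auto simp: E_def)
    thus "G A B \<le> (\<Sum>j=0..K. of_bool ((A, B) \<in> D j) * G A B)" using j by simp
  qed
  also have "\<dots> = (\<Sum>j=0..K. \<Sum>(A, B)\<in>E. of_bool ((A, B) \<in> D j) * G A B)"
    unfolding case_prod_unfold by (rule sum.swap)
  also have "\<dots> \<le> (\<Sum>j=0..K. \<Sum>(A, B)\<in>D j. G A B)"
  proof (intro sum_mono)
    fix j
    have "(\<Sum>(A, B)\<in>E. of_bool ((A, B) \<in> D j) * G A B) = (\<Sum>(A, B)\<in>E \<inter> D j. G A B)"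
      using finE by (intro sum.mono_neutral_cong_right) auto
    also have "\<dots> \<le> (\<Sum>(A, B)\<in>D j. G A B)"
      using finD Gn by (intro sum_mono2) (auto simp: D_def split: if_splits)
    finally show "(\<Sum>(A, B)\<in>E. of_bool ((A, B) \<in> D j) * G A B) \<le> (\<Sum>(A, B)\<in>D j. G A B)" .
  qed
  also have "\<dots> \<le> (\<Sum>j=0..K. 32 / T ^ j * (\<Sum>(A, B)\<in>F j. G A B))"
  proof (intro sum_mono)
    fix j assume j: "j \<in> {0..K}"
    show "(\<Sum>(A, B)\<in>D j. G A B) \<le> 32 / T ^ j * (\<Sum>(A, B)\<in>F j. G A B)"
    proof (cases "j = 0")
      case False
      thus ?thesis using sum_G_top_scale[of j] j by (simp add: D_def)
    next
      case True
      have finF: "finite (F 0)"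
        by (rule finite_subset[of _ "Pow P \<times> Pow P"]) (auto simp: F_def finite_P)
      have "D 0 \<subseteq> F 0" using card_High[of _ 0] R_sub by (auto simp: D_def F_def Low_def)
      hence "(\<Sum>(A, B)\<in>D 0. G A B) \<le> 1 * (\<Sum>(A, B)\<in>F 0. G A B)"
        using finF G_nonneg by (simp only: mult_1, intro sum_mono2) (auto simp: F_def)
      also have "\<dots> \<le> 32 * (\<Sum>(A, B)\<in>F 0. G A B)"
        using G_nonneg by (intro mult_right_mono sum_nonneg) (auto simp: F_def)
      finally show ?thesis using True by simp
    qed
  qed
  also have "\<dots> = 32 * (\<Sum>j=0..K. 1 / T ^ j * (\<Sum>(A, B)\<in>F j. G A B))"
    by (simp add: sum_distrib_left)
  finally show ?thesis unfolding E_def .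
qed

section \<open>The bound for \<open>T1\<close> in terms of the scale sums\<close>

lemma sum_G_all:
  "(\<Sum>A\<in>R. \<Sum>B\<in>R. G A B) \<le> (\<Sum>(A, B)\<in>F K. G A B)"
proof -
  have finF: "finite (F K)"
    by (rule finite_subset[of _ "Pow P \<times> Pow P"]) (auto simp: F_def finite_P)
  have "R \<times> R \<subseteq> F K"
    using card_Low[of _ K] R_sub by (auto simp: F_def High_def)
  hence "(\<Sum>(A, B)\<in>R \<times> R. G A B) \<le> (\<Sum>(A, B)\<in>F K. G A B)"
    using finF G_nonneg by (intro sum_mono2) (auto simp: F_def)
  thus ?thesis by (simp add: sum.cartesian_product)
qed

text \<open>The general pairs are covered by the summand \<open>j = K\<close>, the pairs with equal
  large primes by \<open>sum_G_near\<close>. Of the four factors \<open>exp 11\<close>, one comes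
  from \<open>T1_le_family\<close>, two from the square of the family size and one from
  \<open>V_common\<close>.\<close>

lemma T1_le:
  assumes M: "M > 0"
  shows "T1 N \<le> 10 ^ 6 * exp 44 * T ^ (K + 2) * (\<Sum>j=0..K. 1 / T ^ j * (\<Sum>(A, B)\<in>F j. G A B)) / M\<^sup>2"
proof -
  define X where "X = Sigma R V"
  define \<phi> where "\<phi> = (\<lambda>(A, p). p * \<Prod>A :: nat)"
  define t where "t = T ^ (K + 2)"
  define S where "S = (\<Sum>j=0..K. 1 / T ^ j * (\<Sum>(A, B)\<in>F j. G A B))"
  have t0: "t > 0" unfolding t_def using T_ge_1 by simp
  have N0: "real N > 0" using N_pos by simp
  have finX: "finite X" unfolding X_def using finite_R finite_V by auto
  have SF0: "(\<Sum>(A, B)\<in>F j. G A B) \<ge> 0" for j using G_nonneg by (intro sum_nonneg) (auto simp: F_def)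
  have cardX: "real (card X) = (\<Sum>A\<in>R. real (card (V A)))"
    unfolding X_def using finite_R finite_V by simp
  have "real N / (exp 11 * t) * M \<le> real (card X)"
    unfolding cardX M_def sum_distrib_left t_def by (intro sum_mono card_V)
  moreover have "real N / (exp 11 * t) * M > 0" using N0 t0 M by simp
  ultimately have cX: "(real N / (exp 11 * t) * M)\<^sup>2 \<le> (real (card X))\<^sup>2" "real (card X) > 0"
    by (auto intro: power_mono)
  have phi: "\<phi> x \<in> {1..N} \<and> real N / exp 11 \<le> real (\<phi> x)" if x: "x \<in> X" for x
  proof -
    obtain A p where xx: "x = (A, p)" "A \<in> R" "p \<in> V A" using x by (auto simp: X_def)
    have pos: "real (\<Prod>A) > 0" using xx R_sub prod_pos_P by auto
    have "real N / real (\<Prod>A) / exp 11 < real p" "real p \<le> real N / real (\<Prod>A)" "prime p"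
      using xx by (auto simp: V_def)
    hence "real N / exp 11 \<le> real p * real (\<Prod>A)" "real p * real (\<Prod>A) \<le> real N" "p > 0"
      using pos prime_gt_0_nat by (simp_all add: field_simps del: of_nat_prod)
    moreover have "real (\<phi> x) = real p * real (\<Prod>A)" unfolding \<phi>_def xx by simp
    moreover have "real p * real (\<Prod>A) > 0" using pos \<open>p > 0\<close> by (simp del: of_nat_prod)
    ultimately have "real (\<phi> x) > 0" "real (\<phi> x) \<le> real N" "real N / exp 11 \<le> real (\<phi> x)" by simp_all
    thus ?thesis by simp
  qed
  have "(\<Sum>x\<in>X. \<Sum>y\<in>X. real (gcd (\<phi> x) (\<phi> y)))
      = (\<Sum>A\<in>R. \<Sum>p\<in>V A. \<Sum>B\<in>R. \<Sum>q\<in>V B. real (gcd (p * \<Prod>A) (q * \<Prod>B)))"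
  proof -
    have "(\<Sum>x\<in>X. f x) = (\<Sum>A\<in>R. \<Sum>p\<in>V A. f (A, p))" for f :: "nat set \<times> nat \<Rightarrow> real"
      unfolding X_def using finite_R finite_V by (subst sum.Sigma) auto
    thus ?thesis by (simp add: \<phi>_def)
  qed
  also have "\<dots> = (\<Sum>A\<in>R. \<Sum>B\<in>R. \<Sum>p\<in>V A. \<Sum>q\<in>V B. real (gcd (p * \<Prod>A) (q * \<Prod>B)))"
    by (intro sum.cong refl sum.swap)
  also have "\<dots> \<le> (\<Sum>A\<in>R. \<Sum>B\<in>R. (84\<^sup>2 * (real N)\<^sup>2 / t\<^sup>2) * G A B
       + (84 * exp 11 * (real N)\<^sup>2 / t) * (of_bool (near A B) * G A B))"
  proof (intro sum_mono)
    fix A B assume AB: "A \<in> R" "B \<in> R"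
    have pos: "real (\<Prod>A) > 0" "real (\<Prod>B) > 0" using prod_pos_P[OF R_sub] AB by auto
    have GAB: "real (\<Prod>(A \<inter> B)) * (1 / real (\<Prod>A)) * (1 / real (\<Prod>B)) = G A B"
      using AB R_sub by (intro G_eq) auto
    have "(\<Sum>p\<in>V A. \<Sum>q\<in>V B. real (gcd (p * \<Prod>A) (q * \<Prod>B)))
       \<le> (\<Sum>p\<in>V A. \<Sum>q\<in>V B. real (\<Prod>(A \<inter> B)) * (1 + (if p = q then real p else 0)))"
      using AB by (intro sum_mono gcd_prod)
    also have "\<dots> = real (\<Prod>(A \<inter> B)) * (real (card (V A)) * real (card (V B)) + (\<Sum>p\<in>V A. \<Sum>q\<in>V B. if p = q then real p else 0))"
      by (simp only: sum_distrib_left[symmetric] sum.distrib) simp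
    also have "(\<Sum>p\<in>V A. \<Sum>q\<in>V B. if p = q then real p else 0) = (\<Sum>p\<in>V A \<inter> V B. real p)"
      using finite_V by (simp add: sum.delta sum.inter_restrict)
    also have "real (\<Prod>(A \<inter> B)) * (real (card (V A)) * real (card (V B)) + (\<Sum>p\<in>V A \<inter> V B. real p))
      \<le> real (\<Prod>(A \<inter> B)) * ((84 * real N / t * (1 / real (\<Prod>A))) * (84 * real N / t * (1 / real (\<Prod>B)))
         + of_bool (near A B) * (84 * exp 11 * (real N)\<^sup>2 / t * (1 / real (\<Prod>A)) * (1 / real (\<Prod>B))))"
    proof (intro mult_left_mono add_mono mult_mono)
      show "real (card (V A)) \<le> 84 * real N / t * (1 / real (\<Prod>A))" "real (card (V B)) \<le> 84 * real N / t * (1 / real (\<Prod>B))"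
        using card_V(2) AB unfolding t_def by auto
      show "(\<Sum>p\<in>V A \<inter> V B. real p) \<le> of_bool (near A B) * (84 * exp 11 * (real N)\<^sup>2 / t * (1 / real (\<Prod>A)) * (1 / real (\<Prod>B)))"
        using V_common[OF AB] unfolding t_def by (cases "near A B") simp_all
      show "0 \<le> 84 * real N / t * (1 / real (\<Prod>A))" using t0 pos by (simp del: of_nat_prod)
    qed (auto intro: prod_nonneg)
    also have "\<dots> = (84\<^sup>2 * (real N)\<^sup>2 / t\<^sup>2) * (real (\<Prod>(A \<inter> B)) * (1 / real (\<Prod>A)) * (1 / real (\<Prod>B)))
       + (84 * exp 11 * (real N)\<^sup>2 / t) * (of_bool (near A B) * (real (\<Prod>(A \<inter> B)) * (1 / real (\<Prod>A)) * (1 / real (\<Prod>B))))"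
      by (simp add: algebra_simps power2_eq_square del: of_nat_prod)
    finally show "(\<Sum>p\<in>V A. \<Sum>q\<in>V B. real (gcd (p * \<Prod>A) (q * \<Prod>B)))
      \<le> (84\<^sup>2 * (real N)\<^sup>2 / t\<^sup>2) * G A B + (84 * exp 11 * (real N)\<^sup>2 / t) * (of_bool (near A B) * G A B)"
      unfolding GAB .
  qed
  also have "\<dots> = (84\<^sup>2 * (real N)\<^sup>2 / t\<^sup>2) * (\<Sum>A\<in>R. \<Sum>B\<in>R. G A B)
     + (84 * exp 11 * (real N)\<^sup>2 / t) * (\<Sum>A\<in>R. \<Sum>B\<in>R. of_bool (near A B) * G A B)"
    by (simp only: sum.distrib sum_distrib_left)
  also have "(\<Sum>A\<in>R. \<Sum>B\<in>R. of_bool (near A B) * G A B) = (\<Sum>(A, B) | A \<in> R \<and> B \<in> R \<and> near A B. G A B)"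
    unfolding sum.cartesian_product using finite_R by (intro sum.mono_neutral_cong_right) auto
  also have "(84\<^sup>2 * (real N)\<^sup>2 / t\<^sup>2) * (\<Sum>A\<in>R. \<Sum>B\<in>R. G A B)
     + (84 * exp 11 * (real N)\<^sup>2 / t) * (\<Sum>(A, B) | A \<in> R \<and> B \<in> R \<and> near A B. G A B)
     \<le> (84\<^sup>2 * (real N)\<^sup>2 / t\<^sup>2) * (t * S) + (84 * exp 11 * (real N)\<^sup>2 / t) * (32 * S)"
  proof (intro add_mono mult_left_mono)
    show "(\<Sum>(A, B) | A \<in> R \<and> B \<in> R \<and> near A B. G A B) \<le> 32 * S" unfolding S_def by (rule sum_G_near)
    \<comment> \<open>Enlarging \<open>T ^ K\<close> to \<open>t\<close> gives away
      \<open>T\<^sup>2\<close>, which brings this part to the size of the bound for equal large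
      primes.\<close>
    have "(\<Sum>(A, B)\<in>F K. G A B) = T ^ K * (1 / T ^ K * (\<Sum>(A, B)\<in>F K. G A B))" using T_ge_1 by simp
    also have "\<dots> \<le> t * S"
    proof (intro mult_mono)
      show "T ^ K \<le> t" unfolding t_def using T_ge_1 by (intro power_increasing) auto
      show "1 / T ^ K * (\<Sum>(A, B)\<in>F K. G A B) \<le> S" unfolding S_def
        using SF0 T_ge_1 by (intro member_le_sum[of K "{0..K}" "\<lambda>j. 1 / T ^ j * (\<Sum>(A, B)\<in>F j. G A B)"]) auto
    qed (use T_ge_1 t0 SF0 in auto)
    finally show "(\<Sum>A\<in>R. \<Sum>B\<in>R. G A B) \<le> t * S" using sum_G_all by linarith
  qed (use t0 in auto)
  also have "\<dots> = (7056 + 2688 * exp 11) * ((real N)\<^sup>2 / t) * S"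
    using t0 by (simp add: field_simps power2_eq_square)
  also have "\<dots> \<le> (10 ^ 6 * exp 11) * ((real N)\<^sup>2 / t) * S"
  proof (intro mult_right_mono)
    have "(1::real) \<le> exp 11" by simp
    hence "7056 + 2688 * exp 11 \<le> 1000000 * exp (11::real)" by linarith
    thus "7056 + 2688 * exp 11 \<le> 10 ^ 6 * exp (11::real)" by simp
    show "S \<ge> 0" unfolding S_def
      by (rule sum_nonneg, rule mult_nonneg_nonneg, use T_ge_1 in simp, rule SF0)
  qed (use t0 in auto)
  finally have g: "(\<Sum>x\<in>X. \<Sum>y\<in>X. real (gcd (\<phi> x) (\<phi> y))) \<le> (10 ^ 6 * exp 11) * ((real N)\<^sup>2 / t) * S" .
  have "T1 N \<le> exp 11 / (real (card X))\<^sup>2 * (\<Sum>x\<in>X. \<Sum>y\<in>X. real (gcd (\<phi> x) (\<phi> y)))"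
    using finX cX(2) N_pos phi by (intro T1_le_family) auto
  also have "\<dots> \<le> exp 11 / (real N / (exp 11 * t) * M)\<^sup>2 * ((10 ^ 6 * exp 11) * ((real N)\<^sup>2 / t) * S)"
  proof (intro mult_mono divide_left_mono cX(1) g)
    have "0 < real N / (exp 11 * t) * M" using M N0 t0 by simp
    thus "0 < (real (card X))\<^sup>2 * (real N / (exp 11 * t) * M)\<^sup>2"
      using cX(2) by (metis mult_pos_pos zero_less_power)
  qed (auto intro!: sum_nonneg)
  also have "\<dots> = 10 ^ 6 * exp 44 * t * S / M\<^sup>2"
  proof -
    have "exp (44::real) = exp 11 * exp 11 * exp 11 * exp 11" by (simp only: exp_add[symmetric]) simp
    thus ?thesis using M N0 t0 by (simp add: field_simps power2_eq_square)
  qed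
  finally show ?thesis unfolding t_def S_def .
qed

section \<open>Evaluation of the scale sums and of \<open>M\<close>\<close>

lemma scale_reciprocals:
  assumes "i \<ge> 1"
  shows "\<bar>(\<Sum>p\<in>I i. 1 / real p) - ln T\<bar> \<le> 84"
  unfolding I_def using prime_scale_reciprocals[of "T ^ i" T] T_ge_1 by simp

lemma sum_UN_scales:
  assumes "finite S" "\<And>i. i \<in> S \<Longrightarrow> i \<ge> 1"
  shows "(\<Sum>p\<in>(\<Union>i\<in>S. I i). 1 / real p) \<le> real (card S) * (ln T + 84)"
proof -
  have "(\<Sum>p\<in>(\<Union>i\<in>S. I i). 1 / real p) = (\<Sum>i\<in>S. \<Sum>p\<in>I i. 1 / real p)"
    using assms finite_I I_disjoint by (intro sum.UNION_disjoint) auto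
  also have "\<dots> \<le> (\<Sum>i\<in>S. ln T + 84)"
    using scale_reciprocals assms by (intro sum_mono) (smt (verit))
  finally show ?thesis by simp
qed

text \<open>Rankin's trick, with parameter \<open>y\<close> on the scales up to \<open>j\<close> and \<open>k\<close> above.\<close>

lemma sum_F_le:
  assumes y: "0 < y" "y \<le> 1" and k: "0 < k" "k \<le> 1" and j: "j \<le> K"
  shows "(\<Sum>(A, B)\<in>F j. G A B) \<le> (1 / y) ^ (2 * j * h) * (1 / k) ^ ((K - j) * h)
     * exp ((2 * y + y\<^sup>2) * (real j * (ln T + 84)) + k * (real (K - j) * (ln T + 84)))"
proof -
  define c where "c = (1 / y) ^ (2 * j * h) * (1 / k) ^ ((K - j) * h)"
  have c0: "c \<ge> 0" using y k by (simp add: c_def)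
  \<comment> \<open>The arguments \<open>a\<close> and \<open>b\<close> say whether \<open>p\<close>
    lies in \<open>A\<close> and in \<open>B\<close>. The value 0 at a high prime on which they
    disagree encodes \<open>A \<inter> High j = B \<inter> High j\<close>; \<open>f\<close> is the
    local factor of \<open>G\<close>.\<close>
  define e where "e = (\<lambda>p a b. if p \<in> Low j then (if a then y else 1) * (if b then y else 1)
     else if a = b then (if a then k else 1) else (0::real))"
  define f where "f = (\<lambda>p a b. if a \<or> b then 1 / real p else 1)"
  define g where "g = (\<lambda>p a b. e p a b * f p a b)"
  have g0: "g p a b \<ge> 0" for p a b using y k unfolding g_def e_def f_def by auto
  have LP: "Low j \<subseteq> P" "High j \<subseteq> P" "finite (Low j)" "finite (High j)"
    using P_split[OF j] finite_P by auto
  have split: "prod u P = prod u (Low j) * prod u (High j)" for u :: "nat \<Rightarrow> real"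
    unfolding P_split[OF j] using LP Low_High_disjoint by (intro prod.union_disjoint) auto
  have main: "G A B \<le> c * (\<Prod>p\<in>P. g p (p \<in> A) (p \<in> B))" if AB: "(A, B) \<in> F j" for A B
  proof -
    have sub: "A \<subseteq> P" "B \<subseteq> P" and cl: "card (A \<inter> Low j) + card (B \<inter> Low j) \<le> 2 * j * h"
      and hi: "A \<inter> High j = B \<inter> High j" and ch: "card (A \<inter> High j) \<le> (K - j) * h"
      using AB by (auto simp: F_def)
    have pw: "(\<Prod>p\<in>Q. if p \<in> A then x else 1) = x ^ card (A \<inter> Q)" if "finite Q" for Q A and x :: real
      using that prod.inter_restrict[of Q "\<lambda>_. x" A] by (simp add: Int_commute)
    have "(\<Prod>p\<in>P. f p (p \<in> A) (p \<in> B)) = (\<Prod>p\<in>P \<inter> (A \<union> B). 1 / real p)"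
      unfolding f_def using finite_P by (subst prod.inter_restrict) (auto intro!: prod.cong)
    also have "P \<inter> (A \<union> B) = A \<union> B" using sub by auto
    also have "(\<Prod>p\<in>A \<union> B. 1 / real p) = G A B" unfolding G_def by (simp add: prod_dividef)
    finally have ff: "(\<Prod>p\<in>P. f p (p \<in> A) (p \<in> B)) = G A B" .
    have "(\<Prod>p\<in>Low j. e p (p \<in> A) (p \<in> B)) = (\<Prod>p\<in>Low j. (if p \<in> A then y else 1) * (if p \<in> B then y else 1))"
      unfolding e_def by (intro prod.cong) auto
    also have "\<dots> = y ^ card (A \<inter> Low j) * y ^ card (B \<inter> Low j)"
      using LP by (simp add: prod.distrib pw)
    also have "\<dots> = y ^ (card (A \<inter> Low j) + card (B \<inter> Low j))" by (simp add: power_add)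
    also have "\<dots> \<ge> y ^ (2 * j * h)" using cl y by (intro power_decreasing) auto
    finally have e1: "(\<Prod>p\<in>Low j. e p (p \<in> A) (p \<in> B)) \<ge> y ^ (2 * j * h)" .
    have "(\<Prod>p\<in>High j. e p (p \<in> A) (p \<in> B)) = (\<Prod>p\<in>High j. if p \<in> A then k else 1)"
      unfolding e_def using hi Low_High_disjoint[of j] by (intro prod.cong) auto
    also have "\<dots> = k ^ card (A \<inter> High j)" using LP by (simp add: pw)
    also have "\<dots> \<ge> k ^ ((K - j) * h)" using ch k by (intro power_decreasing) auto
    finally have e2: "(\<Prod>p\<in>High j. e p (p \<in> A) (p \<in> B)) \<ge> k ^ ((K - j) * h)" .
    have "1 = c * (y ^ (2 * j * h) * k ^ ((K - j) * h))"
      using y k by (simp add: c_def power_divide)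
    also have "\<dots> \<le> c * (\<Prod>p\<in>P. e p (p \<in> A) (p \<in> B))"
      unfolding split using e1 e2 y k c0 by (intro mult_left_mono mult_mono) (auto intro: order.trans[rotated])
    finally have "1 * G A B \<le> c * (\<Prod>p\<in>P. e p (p \<in> A) (p \<in> B)) * G A B"
      using G_nonneg[OF sub] by (intro mult_right_mono)
    also have "\<dots> = c * (\<Prod>p\<in>P. g p (p \<in> A) (p \<in> B))"
      unfolding g_def prod.distrib ff by simp
    finally show ?thesis by simp
  qed
  have "(\<Sum>(A, B)\<in>F j. G A B) \<le> (\<Sum>(A, B)\<in>F j. c * (\<Prod>p\<in>P. g p (p \<in> A) (p \<in> B)))"
    by (intro sum_mono) (auto intro: main)
  also have "\<dots> \<le> (\<Sum>(A, B)\<in>Pow P \<times> Pow P. c * (\<Prod>p\<in>P. g p (p \<in> A) (p \<in> B)))"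
    using finite_P c0 g0 by (intro sum_mono2) (auto simp: F_def intro!: mult_nonneg_nonneg prod_nonneg)
  also have "\<dots> = c * (\<Sum>A\<in>Pow P. \<Sum>B\<in>Pow P. \<Prod>p\<in>P. g p (p \<in> A) (p \<in> B))"
    by (simp only: sum.cartesian_product[symmetric] sum_distrib_left)
  also have "(\<Sum>A\<in>Pow P. \<Sum>B\<in>Pow P. \<Prod>p\<in>P. g p (p \<in> A) (p \<in> B))
     = (\<Prod>p\<in>P. (g p True True + g p True False) + (g p False True + g p False False))"
    by (rule sum_Pow_Pow_prod[OF finite_P])
  \<comment> \<open>A low prime may lie in one of the sets (twice \<open>y\<close>) or in both
    (\<open>y\<^sup>2\<close>); a high prime lies in both or in neither.\<close>
  also have "\<dots> = (\<Prod>p\<in>P. 1 + (if p \<in> Low j then 2 * y + y\<^sup>2 else k) * (1 / real p))"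
    by (intro prod.cong refl) (auto simp: g_def e_def f_def power2_eq_square algebra_simps add_divide_distrib)
  also have "\<dots> \<le> exp (\<Sum>p\<in>P. (if p \<in> Low j then 2 * y + y\<^sup>2 else k) * (1 / real p))"
    using finite_P y k by (intro prod_one_plus_le_exp) auto
  also have "(\<Sum>p\<in>P. (if p \<in> Low j then 2 * y + y\<^sup>2 else k) * (1 / real p))
     = (2 * y + y\<^sup>2) * (\<Sum>p\<in>Low j. 1 / real p) + k * (\<Sum>p\<in>High j. 1 / real p)"
  proof -
    have "(\<Sum>p\<in>P. (if p \<in> Low j then 2 * y + y\<^sup>2 else k) * (1 / real p))
       = (\<Sum>p\<in>Low j. (if p \<in> Low j then 2 * y + y\<^sup>2 else k) * (1 / real p))
         + (\<Sum>p\<in>High j. (if p \<in> Low j then 2 * y + y\<^sup>2 else k) * (1 / real p))"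
      unfolding P_split[OF j] using LP Low_High_disjoint by (intro sum.union_disjoint) auto
    also have "(\<Sum>p\<in>High j. (if p \<in> Low j then 2 * y + y\<^sup>2 else k) * (1 / real p)) = (\<Sum>p\<in>High j. k * (1 / real p))"
      using Low_High_disjoint[of j] by (intro sum.cong) auto
    finally show ?thesis by (simp add: sum_distrib_left)
  qed
  also have "exp \<dots> \<le> exp ((2 * y + y\<^sup>2) * (real j * (ln T + 84)) + k * (real (K - j) * (ln T + 84)))"
  proof (subst exp_le_cancel_iff, intro add_mono mult_left_mono)
    show "(\<Sum>p\<in>Low j. 1 / real p) \<le> real j * (ln T + 84)"
      using sum_UN_scales[of "{1..j}"] by (simp add: Low_def)
    show "(\<Sum>p\<in>High j. 1 / real p) \<le> real (K - j) * (ln T + 84)"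
      using sum_UN_scales[of "{j+1..K}"] by (simp add: High_def)
  qed (use y k in auto)
  finally show ?thesis using c0 by (simp add: c_def mult_left_mono)
qed

text \<open>The sum over \<open>R\<close> factors over the scales, since a member is an arbitrary
  choice of \<open>h\<close> primes on each; every factor is an elementary symmetric sum. The 85 is
  the Mertens error 84 plus the 1 lost in \<open>elementary_symmetric_lower\<close>.\<close>

lemma M_lower:
  assumes T: "ln T \<ge> 86"
  shows "((ln T - 85) ^ h / fact h) ^ K \<le> M"
proof -
  define Q where "Q = (\<lambda>n. \<Union>i\<in>{1..n}. I i)"
  define RR where "RR = (\<lambda>n. {A. A \<subseteq> Q n \<and> (\<forall>j\<in>{1..n}. card (A \<inter> I j) = h)})"
  define E where "E = (\<lambda>j. {B. B \<subseteq> I j \<and> card B = h})"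
  define r where "r = (ln T - 85) ^ h / fact h"
  have r0: "r \<ge> 0" unfolding r_def using T by simp
  have finQ: "finite (Q n)" for n unfolding Q_def using finite_I by auto
  have finRR: "finite (RR n)" for n by (rule finite_subset[of _ "Pow (Q n)"]) (auto simp: RR_def finQ)
  have finE: "finite (E n)" for n by (rule finite_subset[of _ "Pow (I n)"]) (auto simp: E_def finite_I)
  have er: "r \<le> (\<Sum>B\<in>E j. 1 / real (\<Prod>B))" if j: "j \<in> {1..K}" for j
  proof -
    have S: "(\<Sum>p\<in>I j. 1 / real p) - 1 \<ge> ln T - 85" using scale_reciprocals[of j] j by (auto simp: abs_le_iff)
    have "r \<le> ((\<Sum>p\<in>I j. 1 / real p) - 1) ^ h / fact h"
      unfolding r_def using S T by (intro divide_right_mono power_mono) auto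
    also have "\<dots> \<le> (\<Sum>B | B \<subseteq> I j \<and> card B = h. 1 / real (\<Prod>B))"
    proof (rule elementary_symmetric_lower[OF finite_I])
      show "1 \<le> (\<Sum>p\<in>I j. 1 / real p)" using S T by linarith
      fix p assume "p \<in> I j"
      hence p: "prime p" "exp (T ^ j) < real p" by (auto simp: I_def)
      have "1 * real h \<le> 2 * real K * real h" using j by (intro mult_right_mono) auto
      hence "real h \<le> T" using hK by linarith
      also have "T \<le> T ^ j" using T_ge_1 j power_increasing[of 1 j T] by auto
      also have "\<dots> \<le> exp (T ^ j)" using exp_ge_add_one_self[of "T ^ j"] by linarith
      finally show "real h \<le> real p \<and> 0 < p" using p prime_gt_0_nat by auto
    qed
    finally show ?thesis by (simp add: E_def)
  qed
  have "r ^ n \<le> (\<Sum>A\<in>RR n. 1 / real (\<Prod>A))" if "n \<le> K" for n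
    using that
  proof (induction n)
    case 0
    have "RR 0 = {{}}" by (auto simp: RR_def Q_def)
    thus ?case by simp
  next
    case (Suc n)
    have QS: "Q (Suc n) = Q n \<union> I (Suc n)" by (auto simp: Q_def atLeastAtMostSuc_conv)
    have disj: "Q n \<inter> I j = {}" if "j > n" for j
    proof -
      have "I i \<inter> I j = {}" if "i \<in> {1..n}" for i
        using that \<open>j > n\<close> by (intro I_disjoint) auto
      thus ?thesis unfolding Q_def by blast
    qed
    define u where "u = (\<lambda>(A, B). A \<union> B :: nat set)"
    have inj: "inj_on u (RR n \<times> E (Suc n))"
    proof (rule inj_on_inverseI)
      fix x assume "x \<in> RR n \<times> E (Suc n)"
      thus "(\<lambda>C. (C \<inter> Q n, C \<inter> I (Suc n))) (u x) = x"
        using disj[of "Suc n"] by (auto simp: u_def RR_def E_def)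
    qed
    have img: "u ` (RR n \<times> E (Suc n)) \<subseteq> RR (Suc n)"
    proof
      fix C assume "C \<in> u ` (RR n \<times> E (Suc n))"
      then obtain A B where C: "C = A \<union> B" and A: "A \<subseteq> Q n" "\<forall>j\<in>{1..n}. card (A \<inter> I j) = h"
        and B: "B \<subseteq> I (Suc n)" "card B = h" by (auto simp: u_def RR_def E_def)
      have "card (C \<inter> I j) = h" if j: "j \<in> {1..Suc n}" for j
      proof (cases "j = Suc n")
        case True
        have "C \<inter> I j = B" using C A B disj[of "Suc n"] True by auto
        thus ?thesis using B by simp
      next
        case False
        have "C \<inter> I j = A \<inter> I j" using C B I_disjoint[OF False] by auto
        thus ?thesis using A j False by auto
      qed
      thus "C \<in> RR (Suc n)" using C A B QS by (auto simp: RR_def)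
    qed
    have "r ^ Suc n = r ^ n * r" by simp
    also have "\<dots> \<le> (\<Sum>A\<in>RR n. 1 / real (\<Prod>A)) * (\<Sum>B\<in>E (Suc n). 1 / real (\<Prod>B))"
      using Suc r0 er[of "Suc n"] by (intro mult_mono) (auto intro!: sum_nonneg prod_nonneg)
    also have "\<dots> = (\<Sum>x\<in>RR n \<times> E (Suc n). 1 / real (\<Prod>(u x)))"
      unfolding sum_product sum.cartesian_product
    proof (intro sum.cong refl, clarify)
      fix A B assume "A \<in> RR n" "B \<in> E (Suc n)"
      hence AB: "A \<subseteq> Q n" "B \<subseteq> I (Suc n)" by (auto simp: RR_def E_def)
      have "\<Prod>(A \<union> B) = \<Prod>A * \<Prod>B"
        using AB disj[of "Suc n"] finite_subset[OF AB(1) finQ] finite_subset[OF AB(2) finite_I]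
        by (intro prod.union_disjoint) auto
      thus "1 / real (\<Prod>A) * (1 / real (\<Prod>B)) = 1 / real (\<Prod>(u (A, B)))"
        by (simp add: u_def del: of_nat_prod)
    qed
    also have "\<dots> = (\<Sum>C\<in>u ` (RR n \<times> E (Suc n)). 1 / real (\<Prod>C))"
      by (simp add: sum.reindex[OF inj] del: of_nat_prod)
    also have "\<dots> \<le> (\<Sum>C\<in>RR (Suc n). 1 / real (\<Prod>C))"
      using img finRR by (intro sum_mono2) (auto intro: prod_nonneg)
    finally show ?case .
  qed
  from this[of K] show ?thesis unfolding r_def M_def R_def RR_def Q_def P_def by simp
qed

end

section \<open>Asymptotics\<close>

lemma ln_fact_upper:
  assumes "h \<ge> 1"
  shows "ln (fact h) \<le> real h * ln (real h) - real h + ln (real h) + 1"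
  using assms
proof (induction h rule: nat_induct_at_least)
  case (Suc h)
  define x where "x = real h"
  have x: "x \<ge> 1" using Suc by (simp add: x_def)
  have "ln (x / (x + 1)) \<le> x / (x + 1) - 1" using x by (intro ln_le_minus_one) auto
  also have "x / (x + 1) - 1 = - 1 / (x + 1)" using x by (simp add: field_simps)
  finally have "ln x - ln (x + 1) \<le> - 1 / (x + 1)" using x by (simp add: ln_div)
  hence "(x + 1) * (ln x - ln (x + 1)) \<le> (x + 1) * (- 1 / (x + 1))" using x by (intro mult_left_mono) auto
  hence "(x + 1) * (ln x - ln (x + 1)) \<le> - 1" using x by simp
  moreover have "ln (fact (Suc h) :: real) = ln (x + 1) + ln (fact h)"
    unfolding fact_Suc x_def by (subst ln_mult) (auto simp: add_ac)
  moreover have "real (Suc h) = x + 1" by (simp add: x_def)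
  ultimately show ?case using Suc.IH unfolding x_def[symmetric] by (simp add: algebra_simps)
qed auto

text \<open>Stirling's formula at \<open>h\<close> close to \<open>k * l\<close>, where
  \<open>l ^ h / h!\<close> has exponent \<open>(k - k * ln k) * l\<close>. The loss consists of 170
  for the shift by 85, of \<open>ln l + 1\<close> from Stirling and of \<open>1 - ln k\<close> from
  rounding \<open>h\<close>.\<close>

lemma poisson_weight_lower:
  fixes k l :: real
  assumes k: "0 < k" "k \<le> 1" and l: "l \<ge> 170" "k * l \<ge> 1"
  defines "h \<equiv> nat \<lfloor>k * l\<rfloor>"
  shows "exp ((k - k * ln k) * l - ln l - (172 - ln k)) \<le> (l - 85) ^ h / fact h"
proof -
  have h: "h \<ge> 1" "real h \<le> k * l" "real h \<ge> k * l - 1"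
    unfolding h_def using l by (auto simp: le_nat_floor)
  have kl: "k * l \<le> l" using k l by simp
  have lnk: "ln k \<le> 0" using k by simp
  have lnh: "ln (real h) \<le> ln k + ln l"
  proof -
    have "ln (real h) \<le> ln (k * l)" using h by (intro ln_mono) auto
    thus ?thesis using k l by (simp add: ln_mult)
  qed
  have "(85 / l) / (1 - 85 / l) \<le> 170 / l" using l by (simp add: field_simps)
  moreover have "ln (1 - 85 / l) \<ge> - ((85 / l) / (1 - 85 / l))"
  proof -
    have "ln (1 / (1 - 85 / l)) \<le> 1 / (1 - 85 / l) - 1" using l by (intro ln_le_minus_one) (simp add: field_simps)
    also have "\<dots> = (85 / l) / (1 - 85 / l)" using l by (simp add: field_simps)
    finally show ?thesis using l by (simp add: ln_div)
  qed
  ultimately have "ln (1 - 85 / l) \<ge> - 170 / l" by simp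
  moreover have "ln (l - 85) = ln l + ln (1 - 85 / l)"
  proof -
    have "l - 85 = l * (1 - 85 / l)" using l by (simp add: field_simps)
    moreover have "1 - 85 / l > 0" using l by simp
    moreover have "l > 0" using l by simp
    ultimately show ?thesis by (simp only: ln_mult_pos)
  qed
  ultimately have "ln (l - 85) \<ge> ln l - 170 / l" by simp
  hence "real h * ln (l - 85) \<ge> real h * (ln l - 170 / l)" by (intro mult_left_mono) auto
  moreover have "real h * (170 / l) \<le> 170"
  proof -
    have "real h * (170 / l) \<le> l * (170 / l)" using order.trans[OF h(2) kl] l by (intro mult_right_mono) auto
    thus ?thesis using l by simp
  qed
  ultimately have a: "real h * ln (l - 85) \<ge> real h * ln l - 170" by (simp add: algebra_simps)
  have "real h * ln (real h) \<le> real h * (ln k + ln l)" using lnh by (intro mult_left_mono) auto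
  hence b: "ln (fact h) \<le> real h * ln k + real h * ln l - real h + ln l + 1"
    using ln_fact_upper[OF h(1)] lnh lnk by (simp add: algebra_simps)
  have "(k * l - 1) * (1 - ln k) \<le> real h * (1 - ln k)" using h lnk by (intro mult_right_mono) auto
  hence c: "(k - k * ln k) * l - 1 + ln k \<le> real h - real h * ln k" by (simp add: algebra_simps)
  have "(k - k * ln k) * l - ln l - (172 - ln k) \<le> real h * ln (l - 85) - ln (fact h)"
    using a b c by linarith
  also have "\<dots> = ln ((l - 85) ^ h / fact h)" using l by (simp add: ln_div ln_realpow)
  finally have "exp ((k - k * ln k) * l - ln l - (172 - ln k)) \<le> exp (ln ((l - 85) ^ h / fact h))"
    by (simp only: exp_le_cancel_iff)
  also have "\<dots> = (l - 85) ^ h / fact h" using l by (intro exp_ln) auto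
  finally show ?thesis .
qed

text \<open>The contributions of all the scales \<open>j\<close> turn out to have the same exponent.\<close>

lemma T1_upper_param:
  fixes z k d l :: real
  assumes z: "0 < z" "z \<le> 1" and k: "0 < k" "k \<le> 1" "k = z + z\<^sup>2"
    and d1: "d = 1 - k + k * ln k" and d2: "d = 2 * k * ln (1 + z) - z\<^sup>2"
    and N: "ln (real N) = exp l ^ (K + 2)" and l: "l \<ge> 170" "k * l \<ge> 1" "l \<ge> 4 * real K"
  shows "T1 N \<le> 10 ^ 6 * exp 44 * (real K + 1)
     * exp ((2 + real K * d) * l + 2 * real K * ln l + real K * (252 + 2 * (172 - ln k)))"
proof -
  define h where "h = nat \<lfloor>k * l\<rfloor>"
  have hkl: "real h \<le> k * l" unfolding h_def using l by auto
  have kl: "k * l \<le> l" using k l by simp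
  have lnz: "ln z \<le> 0" and lnk: "ln k \<le> 0" using z k by auto
  have E: "exp l \<ge> 1 + l + l\<^sup>2 / 2" using l by (intro exp_lower_Taylor_quadratic) auto
  interpret gal_construction N K h "exp l"
  proof
    have "l\<^sup>2 / 2 \<ge> 0" by simp
    thus "45 \<le> exp l" using E l by linarith
    have "2 * real K * real h \<le> 2 * real K * l" using hkl kl by (intro mult_left_mono) auto
    also have "\<dots> = (4 * real K) * l / 2" by simp
    also have "\<dots> \<le> l * l / 2" using l by (intro divide_right_mono mult_right_mono) auto
    also have "\<dots> \<le> exp l" using E l by (simp add: power2_eq_square)
    finally show "2 * real K * real h \<le> exp l" .
  qed (rule N)
  define c where "c = 172 - ln k"
  define b where "b = (1 - d) * l - ln l - c"
  have Mb: "exp (real K * b) \<le> M"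
  proof -
    have "exp b \<le> (l - 85) ^ h / fact h"
      using poisson_weight_lower[OF k(1,2) l(1,2)] unfolding b_def c_def h_def d1 by simp
    hence "exp b ^ K \<le> ((l - 85) ^ h / fact h) ^ K" by (intro power_mono) auto
    also have "\<dots> \<le> M" using M_lower l by simp
    finally show ?thesis by (simp add: exp_of_nat_mult)
  qed
  hence M0: "M > 0" by (meson exp_gt_zero less_le_trans)
  have "exp (2 * (real K * b)) = (exp (real K * b))\<^sup>2" by (simp add: exp_double)
  also have "\<dots> \<le> M\<^sup>2" using Mb by (intro power_mono) auto
  finally have M2: "exp (2 * (real K * b)) \<le> M\<^sup>2" .
  have F_le: "1 / exp l ^ j * (\<Sum>(A, B)\<in>F j. G A B) \<le> exp (real K * (1 - d) * l + 252 * real K)"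
    if j: "j \<in> {0..K}" for j
  proof -
    define i where "i = real (K - j)"
    have i: "i \<ge> 0" "real j + i = real K" using j by (auto simp: i_def)
    \<comment> \<open>The parameter \<open>z\<close> minimises
      \<open>2 * y + y\<^sup>2 - 2 * k * ln y\<close>, because
      \<open>k = z + z\<^sup>2\<close>.\<close>
    have "(\<Sum>(A, B)\<in>F j. G A B) \<le> (1 / z) ^ (2 * j * h) * (1 / k) ^ ((K - j) * h)
     * exp ((2 * z + z\<^sup>2) * (real j * (ln (exp l) + 84)) + k * (real (K - j) * (ln (exp l) + 84)))"
      using z k j by (intro sum_F_le) auto
    also have "(1 / z) ^ (2 * j * h) = exp (real (2 * j * h) * - ln z)"
      using z by (simp only: exp_of_nat_mult exp_minus exp_ln inverse_eq_divide)
    also have "(1 / k) ^ ((K - j) * h) = exp (real ((K - j) * h) * - ln k)"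
      using k by (simp only: exp_of_nat_mult exp_minus exp_ln inverse_eq_divide)
    also have "exp (real (2 * j * h) * - ln z) * exp (real ((K - j) * h) * - ln k)
        * exp ((2 * z + z\<^sup>2) * (real j * (ln (exp l) + 84)) + k * (real (K - j) * (ln (exp l) + 84)))
       = exp ((2 * real j * - ln z + i * - ln k) * real h + (2 * z + z\<^sup>2) * (real j * (l + 84)) + k * (i * (l + 84)))"
      unfolding of_nat_mult i_def[symmetric] by (simp add: exp_add[symmetric]) (simp add: algebra_simps)
    also have "\<dots> \<le> exp (real j * l + (real K * (1 - d) * l + 252 * real K))"
    proof (subst exp_le_cancel_iff)
      have "(2 * real j * - ln z + i * - ln k) * real h \<le> (2 * real j * - ln z + i * - ln k) * (k * l)"
        using hkl i lnz lnk by (intro mult_left_mono add_nonneg_nonneg mult_nonneg_nonneg) auto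
      moreover have "(2 * z + z\<^sup>2) * (real j * 84) \<le> 3 * (real j * 84)"
        using z power_le_one[of z 2] by (intro mult_right_mono) auto
      moreover have "k * (i * 84) \<le> 1 * (i * 84)" using k i by (intro mult_right_mono) auto
      moreover have "252 * real j + 84 * i \<le> 252 * real K" using i by simp
      \<comment> \<open>Each scale up to \<open>j\<close> contributes the exponent
        \<open>2 - d\<close>, each scale above it \<open>1 - d\<close>; the surplus of
        \<open>j\<close> is exactly the saving \<open>1 / T ^ j\<close>.\<close>
      moreover have "2 * z + z\<^sup>2 - 2 * k * ln z = 2 - d"
      proof -
        have "k = z * (1 + z)" using k(3) by (simp add: power2_eq_square algebra_simps)
        hence "ln k = ln z + ln (1 + z)" using z by (simp add: ln_mult)
        hence "k * ln k = k * ln z + k * ln (1 + z)" by (simp add: algebra_simps)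
        thus ?thesis using d1 d2 k(3) by (simp add: algebra_simps)
      qed
      hence "(2 * z + z\<^sup>2 - 2 * k * ln z) * (real j * l) + (k - k * ln k) * (i * l)
          = (2 - d) * (real j * l) + (1 - d) * (i * l)" using d1 by simp
      moreover have "(2 - d) * (real j * l) + (1 - d) * (i * l) = real j * l + real K * (1 - d) * l"
        using i(2)[symmetric] by (simp add: algebra_simps)
      ultimately show "(2 * real j * - ln z + i * - ln k) * real h + (2 * z + z\<^sup>2) * (real j * (l + 84)) + k * (i * (l + 84))
         \<le> real j * l + (real K * (1 - d) * l + 252 * real K)"
        by (simp add: algebra_simps)
    qed
    also have "\<dots> = exp l ^ j * exp (real K * (1 - d) * l + 252 * real K)"
      by (simp add: exp_add exp_of_nat_mult)
    finally show ?thesis by (simp add: divide_le_eq mult.commute)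
  qed
  have "T1 N \<le> 10 ^ 6 * exp 44 * exp l ^ (K + 2) * (\<Sum>j=0..K. 1 / exp l ^ j * (\<Sum>(A, B)\<in>F j. G A B)) / M\<^sup>2"
    by (rule T1_le[OF M0])
  also have "\<dots> \<le> 10 ^ 6 * exp 44 * exp l ^ (K + 2) * ((real K + 1) * exp (real K * (1 - d) * l + 252 * real K)) / exp (2 * (real K * b))"
  proof (intro frac_le mult_left_mono M2)
    have "(\<Sum>j=0..K. 1 / exp l ^ j * (\<Sum>(A, B)\<in>F j. G A B)) \<le> (\<Sum>j=0..K. exp (real K * (1 - d) * l + 252 * real K))"
      by (intro sum_mono F_le)
    thus "(\<Sum>j=0..K. 1 / exp l ^ j * (\<Sum>(A, B)\<in>F j. G A B)) \<le> (real K + 1) * exp (real K * (1 - d) * l + 252 * real K)"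
      by (simp add: add.commute)
  qed auto
  also have "exp l ^ (K + 2) = exp ((real K + 2) * l)" 
    by (simp only: exp_of_nat_mult[symmetric] of_nat_add of_nat_numeral)
  also have "10 ^ 6 * exp 44 * exp ((real K + 2) * l) * ((real K + 1) * exp (real K * (1 - d) * l + 252 * real K)) / exp (2 * (real K * b))
    = 10 ^ 6 * exp 44 * (real K + 1) * (exp ((real K + 2) * l) * exp (real K * (1 - d) * l + 252 * real K) / exp (2 * (real K * b)))"
    by simp
  \<comment> \<open>The leading exponent is
    \<open>(K + 2) + K * (1 - d) - 2 * K * (1 - d) = 2 + K * d\<close>, where 2 is the price of the
    two ends without scales.\<close>
  also have "exp ((real K + 2) * l) * exp (real K * (1 - d) * l + 252 * real K) / exp (2 * (real K * b))
    = exp ((2 + real K * d) * l + 2 * real K * ln l + real K * (252 + 2 * c))"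
    unfolding b_def by (simp add: exp_add[symmetric] exp_diff[symmetric]) (simp add: algebra_simps)
  finally show ?thesis unfolding c_def .
qed

lemma T1_upper_eventually:
  fixes z k d \<epsilon> :: real
  assumes z: "0 < z" "z \<le> 1" and k: "0 < k" "k \<le> 1" "k = z + z\<^sup>2"
    and d1: "d = 1 - k + k * ln k" and d2: "d = 2 * k * ln (1 + z) - z\<^sup>2" and d0: "d \<ge> 0" and e: "\<epsilon> > 0"
  shows "\<forall>\<^sub>F N in sequentially. T1 N \<le> ln (real N) powr (d + \<epsilon>)"
proof -
  \<comment> \<open>As \<open>L N = (K + 2) * l N\<close>, the slack \<epsilon> \<open>* L N\<close>
    exceeds \<open>4 * l N\<close>: two parts pay for the uncovered ends, one for
    \<open>2 * K * ln (l N)\<close> and one for the constant \<open>c\<close>.\<close>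
  obtain K :: nat where K: "real K > 4 / \<epsilon>" using reals_Archimedean2 by blast
  define L where "L = (\<lambda>N::nat. ln (ln (real N)))"
  define l where "l = (\<lambda>N. L N / real (K + 2))"
  define c where "c = ln (10 ^ 6 * exp 44 * (real K + 1)) + real K * (252 + 2 * (172 - ln k))"
  have L_top: "filterlim L at_top sequentially"
    unfolding L_def by (intro filterlim_compose[OF ln_at_top] filterlim_compose[OF ln_at_top filterlim_real_sequentially])
  have l_top: "filterlim l at_top sequentially"
    unfolding l_def divide_inverse
    by (subst mult.commute, intro filterlim_tendsto_pos_mult_at_top[OF tendsto_const _ L_top]) auto
  have ev1: "\<forall>\<^sub>F N in sequentially. l N \<ge> u" for u
    using l_top by (simp add: filterlim_at_top)
  have "((\<lambda>x::real. ln x / x) \<longlongrightarrow> 0) at_top" by (rule ln_x_over_x_tendsto_0)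
  hence "\<forall>\<^sub>F x::real in at_top. ln x / x < 1 / (2 * real K + 1)"
    by (rule order_tendstoD(2)) simp
  hence ev2: "\<forall>\<^sub>F N in sequentially. ln (l N) / l N < 1 / (2 * real K + 1)"
    using l_top by (rule eventually_compose_filterlim)
  show ?thesis
    using ev1[of 170] ev1[of "1 / k"] ev1[of "4 * real K"] ev1[of c] ev2
  proof eventually_elim
    case (elim N)
    have lpos: "l N > 0" using elim by linarith
    have "L N > 0" using lpos by (simp add: l_def zero_less_divide_iff)
    have lnN1: "ln (real N) > 1"
    proof (rule ccontr)
      assume "\<not> ln (real N) > 1"
      \<comment> \<open>For \<open>N = 0\<close> this uses \<open>ln 0 = 0\<close>, as does the next
        line when \<open>ln N = 0\<close>.\<close>
      moreover have "ln (real N) \<ge> 0" by (cases "N = 0") auto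
      ultimately have "ln (ln (real N)) \<le> 0" by (cases "ln (real N) = 0") auto
      thus False using \<open>L N > 0\<close> by (simp add: L_def)
    qed
    have "exp (l N) ^ (K + 2) = exp (L N)" unfolding l_def by (simp add: exp_of_nat_mult[symmetric] del: of_nat_add power_Suc)
    hence N: "ln (real N) = exp (l N) ^ (K + 2)" using lnN1 by (simp add: L_def)
    have kl: "k * l N \<ge> 1" using elim(2) k by (simp add: field_simps)
    have "T1 N \<le> 10 ^ 6 * exp 44 * (real K + 1)
     * exp ((2 + real K * d) * l N + 2 * real K * ln (l N) + real K * (252 + 2 * (172 - ln k)))"
      by (rule T1_upper_param[OF z k d1 d2 N elim(1) kl elim(3)])
    also have "10 ^ 6 * exp 44 * (real K + 1) = exp (ln (10 ^ 6 * exp 44 * (real K + 1)))"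
      by (subst exp_ln) (auto intro: add_nonneg_pos)
    also have "\<dots> * exp ((2 + real K * d) * l N + 2 * real K * ln (l N) + real K * (252 + 2 * (172 - ln k)))
      = exp ((2 + real K * d) * l N + 2 * real K * ln (l N) + c)"
      unfolding c_def by (simp only: exp_add[symmetric]) (simp add: algebra_simps)
    also have "\<dots> \<le> exp ((d + \<epsilon>) * L N)"
    proof (subst exp_le_cancel_iff)
      have "ln (l N) * (2 * real K + 1) < l N" using elim(5) lpos by (simp add: field_simps)
      moreover have "ln (l N) \<ge> 0" using elim by simp
      ultimately have a: "2 * real K * ln (l N) \<le> l N" by (simp add: algebra_simps)
      have "\<epsilon> * (real K + 2) \<ge> 4" using K e by (simp add: field_simps) 
      hence "\<epsilon> * (real K + 2) * l N \<ge> 4 * l N" using lpos by (intro mult_right_mono) auto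
      moreover have "d * l N \<ge> 0" using d0 lpos by simp
      moreover have "real (K + 2) * l N = L N" unfolding l_def by (simp del: of_nat_add)
      hence "L N = (real K + 2) * l N" by (simp add: add.commute)
      ultimately show "(2 + real K * d) * l N + 2 * real K * ln (l N) + c \<le> (d + \<epsilon>) * L N"
        using a elim(4) lpos by (simp add: algebra_simps)
    qed
    also have "\<dots> = ln (real N) powr (d + \<epsilon>)" using lnN1 by (simp add: powr_def L_def)
    finally show ?case .
  qed
qed

theorem theorem1:
  "\<exists>\<delta>\<^sub>0::real. \<bar>\<delta>\<^sub>0 - 0.16656\<bar> \<le> 0.000005 \<and> \<delta>\<^sub>0 < 1 / 6 \<and>
     (\<exists>\<epsilon>\<^sub>0 \<epsilon>\<^sub>1 :: nat \<Rightarrow> real. \<epsilon>\<^sub>0 \<longlonglongrightarrow> 0 \<and> \<epsilon>\<^sub>1 \<longlonglongrightarrow> 0 \<and>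
        (\<forall>\<^sub>F N in sequentially. ln (real N) powr (\<delta>\<^sub>0 + \<epsilon>\<^sub>0 N) \<le> T0 N \<and> T0 N \<le> T1 N) \<and>
        T1 \<in> O(\<lambda>N. ln (real N) powr (\<delta>\<^sub>0 + \<epsilon>\<^sub>1 N)))"
proof -
  obtain z k d :: real where z: "0 < z" "z < 1 / 2" and k: "k = z + z\<^sup>2"
    and d1: "d = 1 - k + k * ln k" and d2: "d = 2 * k * ln (1 + z) - z\<^sup>2"
    and d: "\<bar>d - 0.16656\<bar> \<le> 0.000005"
    by (rule exponent_exists)
  have "z\<^sup>2 \<le> (1 / 2)\<^sup>2" using z by (intro power_mono) auto
  moreover have z1: "z \<le> 1" using z by simp
  ultimately have k01: "0 < k" "k \<le> 1" using z k by (auto simp: power2_eq_square add_pos_pos)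
  have "d - 0.16656 \<le> 0.000005" "- (d - 0.16656) \<le> 0.000005" using d unfolding abs_le_iff by blast+
  hence d0: "d \<ge> 0" "d < 1 / 6" by simp_all
  obtain c where c: "c > 0" "\<And>N. N \<ge> 3 \<Longrightarrow> c * ln (real N) powr d \<le> T0 N"
    using T0_lower[OF z(1) k01 d1 d2] by metis
  define L where "L = (\<lambda>N::nat. ln (ln (real N)))"
  \<comment> \<open>The error terms are chosen so that both bounds eventually become equalities;
    what remains is their convergence to 0.\<close>
  define e0 where "e0 = (\<lambda>N. ln (T0 N) / L N - d)"
  define e1 where "e1 = (\<lambda>N. ln (T1 N) / L N - d)"
  have L_top: "filterlim L at_top sequentially"
    unfolding L_def by (intro filterlim_compose[OF ln_at_top] filterlim_compose[OF ln_at_top filterlim_real_sequentially])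
  hence Lpos: "\<forall>\<^sub>F N in sequentially. L N > 0" by (simp add: filterlim_at_top_dense)
  have base: "\<forall>\<^sub>F N in sequentially. N \<ge> 3 \<and> L N > 0 \<and> ln (real N) > 0 \<and> T0 N > 0 \<and> T1 N > 0
      \<and> e0 N \<ge> ln c / L N \<and> e0 N \<le> e1 N"
    using Lpos eventually_ge_at_top[of 3]
  proof eventually_elim
    case (elim N)
    have lnN: "ln (real N) > 0" using elim by simp
    have lo: "c * ln (real N) powr d \<le> T0 N" using c(2) elim by simp
    have pos: "c * ln (real N) powr d > 0" using c(1) lnN by simp
    hence T0p: "T0 N > 0" using lo by linarith
    have le: "T0 N \<le> T1 N" using elim by (intro T0_le_T1) simp
    have "ln (c * ln (real N) powr d) \<le> ln (T0 N)" using lo pos by (intro ln_mono) auto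
    hence "ln c + d * L N \<le> ln (T0 N)" using c(1) lnN by (simp add: ln_mult L_def)
    hence "(ln c + d * L N) / L N \<le> ln (T0 N) / L N" using elim by (intro divide_right_mono) auto
    hence "e0 N \<ge> ln c / L N" using elim by (simp add: e0_def add_divide_distrib)
    moreover have "ln (T0 N) / L N \<le> ln (T1 N) / L N"
      using elim T0p le by (intro divide_right_mono ln_mono) auto
    hence "e0 N \<le> e1 N" by (simp add: e0_def e1_def)
    ultimately show ?case using elim lnN T0p le by auto
  qed
  have up: "\<forall>\<^sub>F N in sequentially. e1 N \<le> \<epsilon>" if "\<epsilon> > 0" for \<epsilon>
    using base T1_upper_eventually[OF z(1) z1 k01 k d1 d2 d0(1) that]
  proof eventually_elim
    case (elim N)
    hence "ln (T1 N) \<le> ln (ln (real N) powr (d + \<epsilon>))" by (intro ln_mono) auto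
    also have "\<dots> = (d + \<epsilon>) * L N" using elim by (simp add: L_def)
    finally have "ln (T1 N) / L N \<le> d + \<epsilon>" using elim by (simp add: divide_le_eq)
    thus ?case by (simp add: e1_def)
  qed
  have lo: "\<forall>\<^sub>F N in sequentially. e0 N \<ge> - \<epsilon>" if "\<epsilon> > 0" for \<epsilon>
  proof -
    have "(\<lambda>N. ln c / L N) \<longlonglongrightarrow> 0"
      by (rule tendsto_divide_0[OF tendsto_const filterlim_at_top_imp_at_infinity[OF L_top]])
    hence "\<forall>\<^sub>F N in sequentially. ln c / L N > - \<epsilon>" using that by (intro order_tendstoD) auto
    thus ?thesis using base by eventually_elim auto
  qed
  \<comment> \<open>Since \<open>e0 \<le> e1\<close> eventually, one bound from below on
    \<open>e0\<close> and one from above on \<open>e1\<close> squeeze both.\<close>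
  have "e0 \<longlonglongrightarrow> 0 \<and> e1 \<longlonglongrightarrow> 0"
  proof (intro conjI; rule tendstoI)
    fix \<epsilon> :: real assume "\<epsilon> > 0"
    hence h: "\<epsilon> / 2 > 0" by simp
    show "\<forall>\<^sub>F N in sequentially. dist (e0 N) 0 < \<epsilon>"
      using base up[OF h] lo[OF h] by eventually_elim (use \<open>\<epsilon> > 0\<close> in \<open>auto simp: dist_real_def abs_less_iff\<close>)
    show "\<forall>\<^sub>F N in sequentially. dist (e1 N) 0 < \<epsilon>"
      using base up[OF h] lo[OF h] by eventually_elim (use \<open>\<epsilon> > 0\<close> in \<open>auto simp: dist_real_def abs_less_iff\<close>)
  qed
  moreover have exact: "\<forall>\<^sub>F N in sequentially. ln (real N) powr (d + e0 N) = T0 N \<and> ln (real N) powr (d + e1 N) = T1 N"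
    using base
  proof eventually_elim
    case (elim N)
    have "ln (real N) powr x = exp (x * L N)" for x using elim by (simp add: powr_def L_def)
    thus ?case using elim by (simp add: e0_def e1_def)
  qed
  moreover have "\<forall>\<^sub>F N in sequentially. ln (real N) powr (d + e0 N) \<le> T0 N \<and> T0 N \<le> T1 N"
    using exact eventually_ge_at_top[of 1] by eventually_elim (simp add: T0_le_T1)
  moreover have "T1 \<in> O(\<lambda>N. ln (real N) powr (d + e1 N))"
    by (rule bigoI[of _ 1], use exact in eventually_elim) simp
  ultimately show ?thesis using d d0(2) by blast
qed

end
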